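(* Under the properties (i) and (ii) stated in the context, solving the fluid–water column system (described in the context) is equivalent to solving the following wave-spring-mass system for $(\zeta,q)$ on $\mathcal E_-$ and $\overline\zeta=\overline\zeta(t)$: $$\begin{cases}\partial_t\zeta+\partial_xq=0\\ (1-\widetilde\mu^2\partial_x^2)\partial_tq+\varepsilon\partial_x\big(\frac{q^2}h\big)+h\,\partial_x\zeta=0\end{cases}\quad\text{in }\mathcal E_-,\qquad\widetilde\mu\ge0,\quad h=1+\varepsilon\zeta,$$ with $$(\zeta,q)\to(0,0)\ \text{ as }x\to-\infty,\qquad q=\frac{d\overline\zeta}{dt}|\mathcal E_+|\ \text{ at }x=-r,$$ coupled with the following second-order integro-differential equations. For $\widetilde\mu=0$: $$\mathcal T^2_{\rm buo}(h_{\rm wc})\frac{d^2\overline\zeta}{dt^2}=-(1+P_0)\overline\zeta+\kappa P_0\mathcal D\overline\zeta+\varepsilon\beta(h,h_{\rm wc})\Big(\frac{d\overline\zeta}{dt}\Big)^2+\zeta(-r),$$ with $$\mathcal T^2_{\rm buo}(h_{\rm wc})=T^2_{\rm buo}+\alpha|\mathcal E_+|+\frac{|\mathcal E_+|^2}{3h_{\rm wc}},\qquad\beta(h,h_{\rm wc})=\frac{|\mathcal E_+|^2}2\Big(\frac1{h^2(-r)}+\frac1{3h_{\rm wc}^2}\Big),$$ and $h_{\rm wc}=h_{\rm wc}(\overline\zeta)=1+\varepsilon\eta_{\rm eq}+\varepsilon\overline\zeta$. For $\widetilde\mu\neq0$: $$\mathcal T^2_{\widetilde\mu,\rm buo}(h,h_{\rm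 wc})\frac{d^2\overline\zeta}{dt^2}=-(1+P_0)\overline\zeta+\kappa P_0\mathcal D\overline\zeta+\varepsilon\widetilde\beta(h,h_{\rm wc})\Big(\frac{d\overline\zeta}{dt}\Big)^2+\mathcal F(-r),$$ with $$\mathcal T^2_{\widetilde\mu,\rm buo}(h,h_{\rm wc})=\mathcal T^2_{\rm buo}(h_{\rm wc})+\frac{\widetilde\mu|\mathcal E_+|}{h(-r)}+\frac{\widetilde\mu^2}{h_{\rm wc}},\qquad\widetilde\beta(h,h_{\rm wc})=\frac{|\mathcal E_+|^2}2\Big(-\frac1{h^2(-r)}+\frac1{3h_{\rm wc}^2}\Big),$$ $$\mathcal F=\frac1h\Big(\varepsilon\frac{\zeta^2}2+R_1\varphi\Big),\qquad\varphi=\zeta+\varepsilon\frac{\zeta^2}2+\varepsilon\frac{q^2}h .$$ Moreover, the discharge in the interior domain is $q=\frac{d\overline\zeta}{dt}|\mathcal E_+|$ in $\mathcal I$, and the interface elevation and discharge in the chamber domain are $\eta=\eta_{\rm eq}+\overline\zeta$ and $q=\frac{d\overline\zeta}{dt}(\ell-x)$ in $\mathcal E_+$.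
   Context: Parameters: $\varepsilon\in(0,1]$, $\widetilde\mu\ge0$ (with $\mu=3\widetilde\mu^2$), $0<r<\ell$, $P_0>0$, $\kappa\ge0$, $h_0,L>0$; $\eta_{\rm eq}<0$ a constant; $m_{\rm wc}=-\varepsilon\eta_{\rm eq}$ (Archimedes' principle); $T_{\rm buo}^2=m_{\rm wc}h_0^2/L^2$. Domains: $\mathcal I=(-r,r)$, $\mathcal E_-=(-\infty,-r)$, $\mathcal E_+=(r,\ell)$, $|\mathcal E_+|=\ell-r$. $\zeta_{\rm w}$ is a constant (flat bottom), $h_{\rm w}=1+\varepsilon\zeta_{\rm w}>0$, $\alpha=2r/h_{\rm w}$. $I$ is the identity and $\mathcal Df(t)=\int_0^te^{-\kappa(t-s)}f(s)\,ds$. For $\widetilde\mu>0$, $u=R_1v$ on $\mathcal E_-$ iff $(I-\widetilde\mu^2\partial_x^2)u=v$ in $\mathcal E_-$, $\partial_xu\to0$ as $x\to-\infty$, $\partial_xu=0$ at $x=-r$ (in $L^2$-based Sobolev spaces). Fluid–water column system. Unknowns: $\zeta,\underline P$ on $\mathcal E_-\cup\mathcal I$; $\eta,\underline{\mathcal P}$ on $\mathcal E_+$; $q$ on $\mathcal E_-\cup\mathcal I\cup\mathcal E_+$; and $\overline\zeta=\overline\zeta(t)$ (an independent unknown). With $h=1+\varepsilon\zeta>0$, $\mathfrak h=1+\varepsilon\eta>0$: $$\partial_t\zeta+\partial_xq=0,\quad(1-\widetilde\mu^2\partial_x^2)\partial_tq+\varepsilon\partial_x\Big(\frac{q^2}h\Big)+h\,\partial_x\zeta=-\frac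 h\varepsilon\partial_x\underline P\quad\text{in }\mathcal E_-\text{ and in }\mathcal I,$$ $$\partial_t\eta+\partial_xq=0,\quad(1-\widetilde\mu^2\partial_x^2)\partial_tq+\varepsilon\partial_x\Big(\frac{q^2}{\mathfrak h}\Big)+\mathfrak h\,\partial_x\eta=-\frac{\mathfrak h}\varepsilon\partial_x\underline{\mathcal P}\quad\text{in }\mathcal E_+,$$ with constraints $\underline P=0$ in $\mathcal E_-$, $\zeta=\zeta_{\rm w}$ in $\mathcal I$, $\eta=\eta_{\rm eq}+\overline\zeta$ in $\mathcal E_+$, far-field and wall conditions $(\zeta,q)\to(0,0)$ as $x\to-\infty$, $q=0$ at $x=\ell$, and Newton's law $$T_{\rm buo}^2\frac{d^2\overline\zeta}{dt^2}=-\overline\zeta-P_0(I-\kappa\mathcal D)\overline\zeta+\eta+\frac1{\varepsilon|\mathcal E_+|}\int_{\mathcal E_+}\underline{\mathcal P}\,dx .$$ In $\mathcal I$ the discharge is then a function of time only, denoted $q_i(t)$. Solutions are taken regular (sufficiently smooth up to the boundary on each of $\mathcal E_-,\mathcal I,\mathcal E_+$, decaying at $-\infty$). Properties assumed: (i) $q_{|_{\mathcal E_-}}=q_i$ at $x=-r$ and $q_{|_{\mathcal E_+}}=q_i$ at $x=r$; (ii) conservation of total energy at order $O(\varepsilon\mu)$ in the non-damped case: when $\kappa=0$, $\frac{d}{dt}\widetilde E_{\rm tot}=3\varepsilon\widetilde\mu^2\big(\int_{\mathcal E_-\cup\mathcal I}R+\int_{\mathcal E_+}\mathfrak R\big)$,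 where $$\widetilde E_{\rm tot}=\int_{\mathcal E_-\cup\mathcal I}\Big(\frac{\zeta^2}2+\frac{q^2}{2h}+\widetilde\mu^2\frac{(\partial_xq)^2}{2h}\Big)+\int_{\mathcal E_+}\Big(\frac{\eta^2}2+\frac{q^2}{2\mathfrak h}+\widetilde\mu^2\frac{(\partial_xq)^2}{2\mathfrak h}\Big)+\frac{T_{\rm buo}^2|\mathcal E_+|}2\Big(\frac{d\overline\zeta}{dt}\Big)^2+\frac{m_{\rm wc}|\mathcal E_+|}\varepsilon\overline\zeta+\frac{P_0|\mathcal E_+|}2\overline\zeta^{\,2},$$ $R=\frac{(\partial_xq)^3}{6h^2}+\frac{q\,\partial_x\zeta\,\partial_t\partial_xq}{3h^2}$ and $\mathfrak R=\frac{(\partial_xq)^3}{6\mathfrak h^2}+\frac{q\,\partial_x\eta\,\partial_t\partial_xq}{3\mathfrak h^2}$. For every $\kappa\ge0$, property (ii) is imposed through the coupling condition to which it reduces under (i), namely $$\frac{\underline P_{|_{\mathcal I}}(r)-\underline P_{|_{\mathcal I}}(-r)}\varepsilon=\Big(\eta+\frac{\underline{\mathcal P}}\varepsilon+\widetilde{\mathfrak E}\Big)(r)-\Big(\zeta_{|_{\mathcal E_-}}+\frac{\underline P_{|_{\mathcal E_-}}}\varepsilon+\mathfrak E_{|_{\mathcal E_-}}\Big)(-r),$$ with $\mathfrak E=\varepsilon\frac{q^2}{2h^2}-\widetilde\mu^2\frac{\partial_x\partial_tq}h$ and $\widetilde{\mathfrak E}=\varepsilon\frac{q^2}{2\mathfrak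 h^2}-\widetilde\mu^2\frac{\partial_x\partial_tq}{\mathfrak h}$. *)

theory Defs
  imports "HOL-Analysis.Analysis"
begin

text \<open>
  A function that is smooth up to the boundary on each of the disjoint open sets
  \<open>E\<^sub>-\<close>, \<open>I\<close>, \<open>E\<^sub>+\<close> is represented by one function per set, defined on the closure of that
  set; the two one-sided traces at a contact point \<open>x = -r\<close> or \<open>x = r\<close> are then the values of two
  different functions.  All unknowns are written \<open>f t x\<close>; values outside
  \<open>J \<times> closure X\<close> are irrelevant.
\<close>

record params =
  eps :: real     \<comment> \<open>\<open>\<epsilon>\<close>\<close>
  mut :: real     \<comment> \<open>\<open>\<mu>\<close> with a tilde\<close>
  rad :: real     \<comment> \<open>\<open>r\<close>\<close>
  ell :: real     \<comment> \<open>\<open>\<ell>\<close>, the position of the wall\<close>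
  P0 :: real
  kappa :: real
  h0 :: real
  len0 :: real    \<comment> \<open>\<open>L\<close>, the length scale\<close>
  eta_eq :: real
  zeta_w :: real

definition h_w :: "params \<Rightarrow> real" where
  "h_w p = 1 + eps p * zeta_w p"

definition admissible :: "params \<Rightarrow> bool" where
  "admissible p \<longleftrightarrow> 0 < eps p \<and> eps p \<le> 1 \<and> 0 \<le> mut p \<and> 0 < rad p \<and> rad p < ell p
     \<and> 0 < P0 p \<and> 0 \<le> kappa p \<and> 0 < h0 p \<and> 0 < len0 p \<and> eta_eq p < 0 \<and> 0 < h_w p"

definition dom_minus :: "params \<Rightarrow> real set" where  "dom_minus p = {..< - rad p}"
definition dom_int :: "params \<Rightarrow> real set" where  "dom_int p = {- rad p <..< rad p}"
definition dom_plus :: "params \<Rightarrow> real set" where  "dom_plus p = {rad p <..< ell p}"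

definition len_plus :: "params \<Rightarrow> real" where  "len_plus p = ell p - rad p"
definition alpha :: "params \<Rightarrow> real" where  "alpha p = 2 * rad p / h_w p"
definition m_wc :: "params \<Rightarrow> real" where  "m_wc p = - eps p * eta_eq p"
definition T_buo_sq :: "params \<Rightarrow> real" where
  "T_buo_sq p = m_wc p * (h0 p)\<^sup>2 / (len0 p)\<^sup>2"

definition time_interval :: "real set \<Rightarrow> bool" where
  "time_interval J \<longleftrightarrow> is_interval J \<and> 0 \<in> J \<and> J \<subseteq> {0..} \<and> J \<noteq> {0}"

text \<open>Derivatives are taken within \<open>J\<close> and within \<open>closure X\<close>, i.e. one-sided at end points.\<close>

definition ddt :: "real set \<Rightarrow> (real \<Rightarrow> real) \<Rightarrow> real \<Rightarrow> real" where
  "ddt J f t = vector_derivative f (at t within J)"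

definition dt :: "real set \<Rightarrow> (real \<Rightarrow> real \<Rightarrow> real) \<Rightarrow> real \<Rightarrow> real \<Rightarrow> real" where
  "dt J f t x = vector_derivative (\<lambda>s. f s x) (at t within J)"

definition dx :: "real set \<Rightarrow> (real \<Rightarrow> real \<Rightarrow> real) \<Rightarrow> real \<Rightarrow> real \<Rightarrow> real" where
  "dx X f t x = vector_derivative (f t) (at x within closure X)"

definition C2_time :: "real set \<Rightarrow> (real \<Rightarrow> real) \<Rightarrow> bool" where
  "C2_time J f \<longleftrightarrow> f differentiable_on J \<and> ddt J f differentiable_on J
     \<and> continuous_on J (ddt J (ddt J f))"

definition cont_tx :: "real set \<Rightarrow> real set \<Rightarrow> (real \<Rightarrow> real \<Rightarrow> real) \<Rightarrow> bool" where
  "cont_tx J X f \<longleftrightarrow> continuous_on (J \<times> closure X) (\<lambda>(t, x). f t x)"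

definition C1_x :: "real set \<Rightarrow> real set \<Rightarrow> (real \<Rightarrow> real \<Rightarrow> real) \<Rightarrow> bool" where
  "C1_x J X f \<longleftrightarrow> (\<forall>t\<in>J. f t differentiable_on closure X) \<and> cont_tx J X f \<and> cont_tx J X (dx X f)"

definition C1_tx :: "real set \<Rightarrow> real set \<Rightarrow> (real \<Rightarrow> real \<Rightarrow> real) \<Rightarrow> bool" where
  "C1_tx J X f \<longleftrightarrow> C1_x J X f \<and> (\<forall>x\<in>closure X. (\<lambda>t. f t x) differentiable_on J)
     \<and> cont_tx J X (dt J f)"

text \<open>Regularity of \<open>(\<zeta>, q)\<close>: every derivative occurring in the equations exists and is continuous up
  to the boundary.\<close>

definition regular_wave ::
    "real set \<Rightarrow> real set \<Rightarrow> (real \<Rightarrow> real \<Rightarrow> real) \<Rightarrow> (real \<Rightarrow> real \<Rightarrow> real) \<Rightarrow> bool" where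
  "regular_wave J X z q \<longleftrightarrow> C1_tx J X z \<and> C1_tx J X q
     \<and> C1_x J X (dt J q) \<and> C1_x J X (dx X (dt J q))"

definition square_integrable :: "real set \<Rightarrow> (real \<Rightarrow> real) \<Rightarrow> bool" where
  "square_integrable X f \<longleftrightarrow> set_integrable lborel X (\<lambda>x. (f x)\<^sup>2)"

text \<open>Decay at \<open>-\<infinity>\<close> in the \<open>L\<^sup>2\<close>-based sense; the pointwise far-field condition is stated separately.\<close>

definition decaying ::
    "real set \<Rightarrow> real set \<Rightarrow> (real \<Rightarrow> real \<Rightarrow> real) \<Rightarrow> (real \<Rightarrow> real \<Rightarrow> real) \<Rightarrow> bool" where
  "decaying J X z q \<longleftrightarrow> (\<forall>t\<in>J.
     square_integrable X (z t) \<and> square_integrable X (dt J z t) \<and> square_integrable X (dx X z t) \<and>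
     square_integrable X (q t) \<and> square_integrable X (dt J q t) \<and> square_integrable X (dx X q t) \<and>
     square_integrable X (dx X (dt J q) t) \<and> square_integrable X (dx X (dx X (dt J q)) t))"

definition far_field ::
    "real set \<Rightarrow> (real \<Rightarrow> real \<Rightarrow> real) \<Rightarrow> (real \<Rightarrow> real \<Rightarrow> real) \<Rightarrow> bool" where
  "far_field J z q \<longleftrightarrow> (\<forall>t\<in>J. (z t \<longlongrightarrow> 0) at_bot \<and> (q t \<longlongrightarrow> 0) at_bot)"

definition hgt :: "params \<Rightarrow> (real \<Rightarrow> real \<Rightarrow> real) \<Rightarrow> real \<Rightarrow> real \<Rightarrow> real" where
  "hgt p z t x = 1 + eps p * z t x"

definition positive_height ::
    "params \<Rightarrow> real set \<Rightarrow> real set \<Rightarrow> (real \<Rightarrow> real \<Rightarrow> real) \<Rightarrow> bool" where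
  "positive_height p J X z \<longleftrightarrow> (\<forall>t\<in>J. \<forall>x\<in>closure X. 0 < hgt p z t x)"

definition mass_eq ::
    "real set \<Rightarrow> real set \<Rightarrow> (real \<Rightarrow> real \<Rightarrow> real) \<Rightarrow> (real \<Rightarrow> real \<Rightarrow> real) \<Rightarrow> bool" where
  "mass_eq J X z q \<longleftrightarrow> (\<forall>t\<in>J. \<forall>x\<in>X. dt J z t x + dx X q t x = 0)"

definition momentum_lhs :: "params \<Rightarrow> real set \<Rightarrow> real set \<Rightarrow>
    (real \<Rightarrow> real \<Rightarrow> real) \<Rightarrow> (real \<Rightarrow> real \<Rightarrow> real) \<Rightarrow> real \<Rightarrow> real \<Rightarrow> real" where
  "momentum_lhs p J X z q t x =
     dt J q t x - (mut p)\<^sup>2 * dx X (dx X (dt J q)) t x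
     + eps p * dx X (\<lambda>s y. (q s y)\<^sup>2 / hgt p z s y) t x
     + hgt p z t x * dx X z t x"

definition momentum_eq :: "params \<Rightarrow> real set \<Rightarrow> real set \<Rightarrow> (real \<Rightarrow> real \<Rightarrow> real) \<Rightarrow>
    (real \<Rightarrow> real \<Rightarrow> real) \<Rightarrow> (real \<Rightarrow> real \<Rightarrow> real) \<Rightarrow> bool" where
  "momentum_eq p J X z q P \<longleftrightarrow> (\<forall>t\<in>J. \<forall>x\<in>X.
     momentum_lhs p J X z q t x = - (hgt p z t x / eps p) * dx X P t x)"

definition memory :: "params \<Rightarrow> (real \<Rightarrow> real) \<Rightarrow> real \<Rightarrow> real" where
  "memory p f t = integral {0..t} (\<lambda>s. exp (- kappa p * (t - s)) * f s)"

text \<open>The unknowns of the fluid--water column system.  Suffixes: \<open>m\<close> for \<open>E\<^sub>-\<close>, \<open>i\<close> for \<open>I\<close>, \<open>c\<close> for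
  the chamber \<open>E\<^sub>+\<close>; \<open>Pm\<close>, \<open>Pint\<close> are the two parts of the surface pressure of the fluid, \<open>Pc\<close> is the
  pressure in the chamber.\<close>

record unknowns =
  zm :: "real \<Rightarrow> real \<Rightarrow> real"
  Pm :: "real \<Rightarrow> real \<Rightarrow> real"
  qm :: "real \<Rightarrow> real \<Rightarrow> real"
  zi :: "real \<Rightarrow> real \<Rightarrow> real"
  Pint :: "real \<Rightarrow> real \<Rightarrow> real"
  qi :: "real \<Rightarrow> real \<Rightarrow> real"
  eta :: "real \<Rightarrow> real \<Rightarrow> real"
  Pc :: "real \<Rightarrow> real \<Rightarrow> real"
  qc :: "real \<Rightarrow> real \<Rightarrow> real"
  zbar :: "real \<Rightarrow> real"

definition regular_unknowns :: "params \<Rightarrow> real set \<Rightarrow> unknowns \<Rightarrow> bool" where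
  "regular_unknowns p J s \<longleftrightarrow>
     regular_wave J (dom_minus p) (zm s) (qm s) \<and> C1_x J (dom_minus p) (Pm s) \<and>
     decaying J (dom_minus p) (zm s) (qm s) \<and>
     regular_wave J (dom_int p) (zi s) (qi s) \<and> C1_x J (dom_int p) (Pint s) \<and>
     regular_wave J (dom_plus p) (eta s) (qc s) \<and> C1_x J (dom_plus p) (Pc s) \<and>
     C2_time J (zbar s)"

definition newton_law :: "params \<Rightarrow> real set \<Rightarrow> unknowns \<Rightarrow> bool" where
  "newton_law p J s \<longleftrightarrow> (\<forall>t\<in>J. \<forall>x\<in>dom_plus p.
     T_buo_sq p * ddt J (ddt J (zbar s)) t =
       - zbar s t - P0 p * (zbar s t - kappa p * memory p (zbar s) t) + eta s t x
       + 1 / (eps p * len_plus p) * integral (dom_plus p) (Pc s t))"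

definition fluid_column_system :: "params \<Rightarrow> real set \<Rightarrow> unknowns \<Rightarrow> bool" where
  "fluid_column_system p J s \<longleftrightarrow>
     regular_unknowns p J s \<and>
     positive_height p J (dom_minus p) (zm s) \<and>
     positive_height p J (dom_int p) (zi s) \<and>
     positive_height p J (dom_plus p) (eta s) \<and>
     mass_eq J (dom_minus p) (zm s) (qm s) \<and>
     momentum_eq p J (dom_minus p) (zm s) (qm s) (Pm s) \<and>
     mass_eq J (dom_int p) (zi s) (qi s) \<and>
     momentum_eq p J (dom_int p) (zi s) (qi s) (Pint s) \<and>
     mass_eq J (dom_plus p) (eta s) (qc s) \<and>
     momentum_eq p J (dom_plus p) (eta s) (qc s) (Pc s) \<and>
     (\<forall>t\<in>J. \<forall>x\<in>dom_minus p. Pm s t x = 0) \<and>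
     (\<forall>t\<in>J. \<forall>x\<in>dom_int p. zi s t x = zeta_w p) \<and>
     (\<forall>t\<in>J. \<forall>x\<in>dom_plus p. eta s t x = eta_eq p + zbar s t) \<and>
     far_field J (zm s) (qm s) \<and>
     (\<forall>t\<in>J. qc s t (ell p) = 0) \<and>
     newton_law p J s"

definition property_i :: "params \<Rightarrow> real set \<Rightarrow> unknowns \<Rightarrow> bool" where
  "property_i p J s \<longleftrightarrow> (\<forall>t\<in>J. qm s t (- rad p) = qi s t (- rad p) \<and> qc s t (rad p) = qi s t (rad p))"

definition frakE :: "params \<Rightarrow> real set \<Rightarrow> real set \<Rightarrow>
    (real \<Rightarrow> real \<Rightarrow> real) \<Rightarrow> (real \<Rightarrow> real \<Rightarrow> real) \<Rightarrow> real \<Rightarrow> real \<Rightarrow> real" where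
  "frakE p J X z q t x =
     eps p * (q t x)\<^sup>2 / (2 * (hgt p z t x)\<^sup>2) - (mut p)\<^sup>2 * dx X (dt J q) t x / hgt p z t x"

text \<open>Energy conservation is imposed, for every \<open>\<kappa> \<ge> 0\<close>, as the pressure jump condition to which it
  reduces when the discharge is continuous at the contact points (the energy balance itself
  carries an additional factor \<open>q\<^sub>i\<close>).\<close>

definition property_ii :: "params \<Rightarrow> real set \<Rightarrow> unknowns \<Rightarrow> bool" where
  "property_ii p J s \<longleftrightarrow> (\<forall>t\<in>J.
     (Pint s t (rad p) - Pint s t (- rad p)) / eps p =
       (eta s t (rad p) + Pc s t (rad p) / eps p
          + frakE p J (dom_plus p) (eta s) (qc s) t (rad p))
       - (zm s t (- rad p) + Pm s t (- rad p) / eps p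
          + frakE p J (dom_minus p) (zm s) (qm s) t (- rad p)))"

text \<open>\<open>u = R\<^sub>1 v\<close> on \<open>E\<^sub>-\<close>, for continuous \<open>v\<close> (the only case needed): an \<open>H\<^sup>2\<close> solution is then
  \<open>C\<^sup>2\<close> up to the boundary.\<close>

definition is_R1 :: "params \<Rightarrow> (real \<Rightarrow> real) \<Rightarrow> (real \<Rightarrow> real) \<Rightarrow> bool" where
  "is_R1 p v u \<longleftrightarrow>
     (let X = dom_minus p;
          u' = (\<lambda>x. vector_derivative u (at x within closure X));
          u'' = (\<lambda>x. vector_derivative u' (at x within closure X))
      in u differentiable_on closure X \<and> u' differentiable_on closure X \<and>
         continuous_on (closure X) u'' \<and>
         square_integrable X u \<and> square_integrable X u' \<and> square_integrable X u'' \<and>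
         (\<forall>x\<in>X. u x - (mut p)\<^sup>2 * u'' x = v x) \<and>
         (u' \<longlongrightarrow> 0) at_bot \<and> u' (- rad p) = 0)"

definition R1 :: "params \<Rightarrow> (real \<Rightarrow> real) \<Rightarrow> real \<Rightarrow> real" where
  "R1 p v = (THE u. is_R1 p v u \<and> (\<forall>x. x \<notin> closure (dom_minus p) \<longrightarrow> u x = 0))"

definition phi :: "params \<Rightarrow> (real \<Rightarrow> real \<Rightarrow> real) \<Rightarrow> (real \<Rightarrow> real \<Rightarrow> real) \<Rightarrow> real \<Rightarrow> real \<Rightarrow> real" where
  "phi p z q t x = z t x + eps p * (z t x)\<^sup>2 / 2 + eps p * (q t x)\<^sup>2 / hgt p z t x"

definition calF :: "params \<Rightarrow> (real \<Rightarrow> real \<Rightarrow> real) \<Rightarrow> (real \<Rightarrow> real \<Rightarrow> real) \<Rightarrow> real \<Rightarrow> real \<Rightarrow> real" where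
  "calF p z q t x = 1 / hgt p z t x * (eps p * (z t x)\<^sup>2 / 2 + R1 p (phi p z q t) x)"

definition h_wc :: "params \<Rightarrow> real \<Rightarrow> real" where
  "h_wc p zb = 1 + eps p * eta_eq p + eps p * zb"

text \<open>In the following coefficients \<open>hb\<close> stands for the trace \<open>h(-r)\<close> and \<open>hc\<close> for \<open>h_wc\<close>.\<close>

definition calT_sq :: "params \<Rightarrow> real \<Rightarrow> real" where
  "calT_sq p hc = T_buo_sq p + alpha p * len_plus p + (len_plus p)\<^sup>2 / (3 * hc)"

definition beta :: "params \<Rightarrow> real \<Rightarrow> real \<Rightarrow> real" where
  "beta p hb hc = (len_plus p)\<^sup>2 / 2 * (1 / hb\<^sup>2 + 1 / (3 * hc\<^sup>2))"

definition calT_mu_sq :: "params \<Rightarrow> real \<Rightarrow> real \<Rightarrow> real" where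
  "calT_mu_sq p hb hc = calT_sq p hc + mut p * len_plus p / hb + (mut p)\<^sup>2 / hc"

definition beta_mu :: "params \<Rightarrow> real \<Rightarrow> real \<Rightarrow> real" where
  "beta_mu p hb hc = (len_plus p)\<^sup>2 / 2 * (- 1 / hb\<^sup>2 + 1 / (3 * hc\<^sup>2))"

definition spring_mass_ode :: "params \<Rightarrow> real set \<Rightarrow>
    (real \<Rightarrow> real \<Rightarrow> real) \<Rightarrow> (real \<Rightarrow> real) \<Rightarrow> bool" where
  "spring_mass_ode p J z zb \<longleftrightarrow> (\<forall>t\<in>J.
     let hb = hgt p z t (- rad p); hc = h_wc p (zb t) in
     calT_sq p hc * ddt J (ddt J zb) t =
       - (1 + P0 p) * zb t + kappa p * P0 p * memory p zb t
       + eps p * beta p hb hc * (ddt J zb t)\<^sup>2 + z t (- rad p))"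

definition spring_mass_ode_mu :: "params \<Rightarrow> real set \<Rightarrow>
    (real \<Rightarrow> real \<Rightarrow> real) \<Rightarrow> (real \<Rightarrow> real \<Rightarrow> real) \<Rightarrow> (real \<Rightarrow> real) \<Rightarrow> bool" where
  "spring_mass_ode_mu p J z q zb \<longleftrightarrow> (\<forall>t\<in>J.
     let hb = hgt p z t (- rad p); hc = h_wc p (zb t) in
     calT_mu_sq p hb hc * ddt J (ddt J zb) t =
       - (1 + P0 p) * zb t + kappa p * P0 p * memory p zb t
       + eps p * beta_mu p hb hc * (ddt J zb t)\<^sup>2 + calF p z q t (- rad p))"

definition wave_spring_mass_system :: "params \<Rightarrow> real set \<Rightarrow>
    (real \<Rightarrow> real \<Rightarrow> real) \<Rightarrow> (real \<Rightarrow> real \<Rightarrow> real) \<Rightarrow> (real \<Rightarrow> real) \<Rightarrow> bool" where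
  "wave_spring_mass_system p J z q zb \<longleftrightarrow>
     regular_wave J (dom_minus p) z q \<and> decaying J (dom_minus p) z q \<and> C2_time J zb \<and>
     positive_height p J (dom_minus p) z \<and> (\<forall>t\<in>J. 0 < h_wc p (zb t)) \<and>
     mass_eq J (dom_minus p) z q \<and>
     (\<forall>t\<in>J. \<forall>x\<in>dom_minus p. momentum_lhs p J (dom_minus p) z q t x = 0) \<and>
     far_field J z q \<and>
     (\<forall>t\<in>J. q t (- rad p) = ddt J zb t * len_plus p) \<and>
     (mut p = 0 \<longrightarrow> spring_mass_ode p J z zb) \<and>
     (mut p \<noteq> 0 \<longrightarrow> spring_mass_ode_mu p J z q zb)"

end

theory Submission
  imports Defs
begin

text \<open>
  In the interior domain and in the chamber the constraints make the elevation a function of time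
  only, so the discharge is affine in \<open>x\<close>; the wall condition and the continuity of the discharge
  determine it from \<open>d\<zeta>/dt\<close> of the column.  The momentum equations then give the pressure explicitly:
  affine in the interior, quadratic in the chamber, up to one function of time each.  Inserting the mean
  of the chamber pressure into Newton's law and eliminating its trace at \<open>x = r\<close> with the
  coupling condition yields an integro-differential equation that involves the exterior only through
  the traces at \<open>x = -r\<close> of \<open>\<zeta>\<close>, \<open>q\<close> and \<open>\<partial>\<^sub>x\<partial>\<^sub>tq\<close>.  Every step is reversible.

  For \<open>\<mu> \<noteq> 0\<close> the last trace is nonlocal.  The exterior momentum equation reads
  \<open>w - \<mu>\<^sup>2 w'' = - \<phi>'\<close> for \<open>w = \<partial>\<^sub>tq\<close>, so \<open>W = \<phi> - \<mu>\<^sup>2 w'\<close> satisfies \<open>W' = - w\<close> and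
  \<open>W - \<mu>\<^sup>2 W'' = \<phi>\<close>.  Correcting the Neumann datum by a decaying exponential gives
  \<open>R\<^sub>1\<phi> = W + \<mu> w(-r) exp ((x + r) / \<mu>)\<close>, whose value at \<open>-r\<close> expresses \<open>\<partial>\<^sub>x\<partial>\<^sub>tq\<close> through \<open>R\<^sub>1\<phi>\<close>.
  (Here \<open>\<mu>\<close> denotes \<open>mut\<close>.)
\<close>

section \<open>One-sided derivatives on intervals\<close>

lemma at_within_interval_neq_bot:
  fixes S :: "real set"
  assumes "is_interval S" "x \<in> S" "y \<in> S" "y \<noteq> x"
  shows "at x within S \<noteq> bot"
proof -
  \<comment> \<open>A connected set with a second point is perfect; nontriviality of the
    within-filter is what makes one-sided derivatives unique.\<close>
  have "x islimpt S"
    using assms by (intro connected_imp_perfect) (auto simp: is_interval_connected)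
  then show ?thesis
    by (simp add: trivial_limit_within)
qed

lemma has_real_derivative_vector_derivative_within:
  "f differentiable (at x within S) \<Longrightarrow>
    (f has_real_derivative vector_derivative f (at x within S)) (at x within S)"
  by (simp add: has_real_derivative_iff_has_vector_derivative vector_derivative_works)

lemma vector_derivative_within_eq_real:
  "(f has_real_derivative D) (at x within S) \<Longrightarrow> at x within S \<noteq> bot \<Longrightarrow>
    vector_derivative f (at x within S) = D"
  by (simp add: has_real_derivative_iff_has_vector_derivative vector_derivative_within)

lemma has_real_derivative_within_cong:
  fixes f :: "real \<Rightarrow> real"
  assumes "(f has_real_derivative D) (at x within S)" "x \<in> S" "\<And>y. y \<in> S \<Longrightarrow> f y = g y"
  shows "(g has_real_derivative D) (at x within S)"
  using has_field_derivative_transform_within[OF assms(1), of 1 g] assms by auto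

lemma at_within_atMost_neq_bot:
  fixes a x :: real
  assumes "x \<le> a"
  shows "at x within {..a} \<noteq> bot"
  using assms by (intro at_within_interval_neq_bot[where y="x - 1"]) auto

text \<open>The equations are imposed on the open half line only. Continuity up to the boundary
  carries them to \<open>x = -r\<close>, where the traces are taken.\<close>

lemma zero_on_atMost:
  fixes f :: "real \<Rightarrow> real"
  assumes "continuous_on {..a} f" "\<And>x. x < a \<Longrightarrow> f x = 0" "x \<le> a"
  shows "f x = 0"
  using continuous_constant_on_closure[of "{..<a}" f 0 x] assms by simp

subsection \<open>Square integrability on a half line\<close>

lemma set_integrable_atMost_iff_lessThan:
  "set_integrable lborel {..a} (f :: real \<Rightarrow> real) \<longleftrightarrow> set_integrable lborel {..<a} f"
proof -
  have "set_integrable lborel {..a} f" if "set_integrable lborel {..<a} f"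
  proof -
    have "set_integrable lborel {a} f"
      using borel_integrable_atLeastAtMost'[of a a f] by simp
    then have "set_integrable lborel ({..<a} \<union> {a}) f"
      using that by (intro set_integrable_Un) auto
    moreover have "{..<a} \<union> {a} = {..a}" by auto
    ultimately show ?thesis by simp
  qed
  then show ?thesis
    using set_integrable_subset[of lborel "{..a}" f "{..<a}"] by force
qed

text \<open>Domination near minus infinity suffices, since continuity handles the remaining compact
  interval. This admits bounds that hold only where the wave is small, as for
  \<open>phi\<close>.\<close>

lemma square_integrable_eventually_bound:
  fixes f g :: "real \<Rightarrow> real"
  assumes cont: "continuous_on {..a} f"
    and int: "set_integrable lborel {..<a} g"
    and bound: "eventually (\<lambda>x. (f x)\<^sup>2 \<le> g x) at_bot"
  shows "square_integrable {..<a} f"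
proof -
  obtain b where b: "(f x)\<^sup>2 \<le> g x" if "x \<le> b" for x
    using bound by (auto simp: eventually_at_bot_linorder)
  define c where "c = min a b"
  have meas: "set_borel_measurable lborel {..<c} (\<lambda>x. (f x)\<^sup>2)"
    unfolding set_borel_measurable_def measurable_lborel2
    by (intro borel_measurable_continuous_on_indicator continuous_intros
        continuous_on_subset[OF cont]) (auto simp: c_def)
  have "set_integrable lborel {..<c} g"
    using int by (rule set_integrable_subset) (auto simp: c_def)
  then have "set_integrable lborel {..<c} (\<lambda>x. (f x)\<^sup>2)"
    by (rule set_integrable_bound[OF _ meas])
      (auto intro!: AE_I2 order_trans[OF b] simp: c_def)
  moreover have "set_integrable lborel {c..a} (\<lambda>x. (f x)\<^sup>2)"
    by (intro borel_integrable_atLeastAtMost' continuous_intros continuous_on_subset[OF cont]) auto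
  ultimately have "set_integrable lborel ({..<c} \<union> {c..a}) (\<lambda>x. (f x)\<^sup>2)"
    by (intro set_integrable_Un) auto
  then show ?thesis
    unfolding square_integrable_def
    by (rule set_integrable_subset) (auto simp: c_def)
qed

lemma square_integrable_cong:
  "(\<And>x. x < a \<Longrightarrow> f x = g x) \<Longrightarrow> square_integrable {..<a} f \<longleftrightarrow> square_integrable {..<a} g"
  unfolding square_integrable_def by (rule set_integrable_cong) auto

lemma square_integrable_add:
  fixes f g :: "real \<Rightarrow> real"
  assumes "continuous_on {..a} f" "continuous_on {..a} g"
    and "square_integrable {..<a} f" "square_integrable {..<a} g"
  shows "square_integrable {..<a} (\<lambda>x. f x + g x)"
proof (rule square_integrable_eventually_bound)
  show "set_integrable lborel {..<a} (\<lambda>x. 2 * (f x)\<^sup>2 + 2 * (g x)\<^sup>2)"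
    using assms(3,4) unfolding square_integrable_def
    by (intro set_integral_add set_integrable_mult_right) auto
  have "(f x + g x)\<^sup>2 \<le> 2 * (f x)\<^sup>2 + 2 * (g x)\<^sup>2" for x
    using sum_squares_bound[of "f x" "g x"] unfolding power2_sum by linarith
  then show "\<forall>\<^sub>F x in at_bot. (f x + g x)\<^sup>2 \<le> 2 * (f x)\<^sup>2 + 2 * (g x)\<^sup>2"
    by simp
qed (use assms in \<open>auto intro: continuous_intros\<close>)

lemma square_integrable_cmult:
  "square_integrable S f \<Longrightarrow> square_integrable S (\<lambda>x. c * f x)"
  unfolding square_integrable_def power_mult_distrib by (intro set_integrable_mult_right)

text \<open>The reflection \<open>x -> a - x\<close> turns the squared exponential into one of rate
  \<open>2 / m\<close> decaying on \<open>{0..}\<close>.\<close>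

lemma square_integrable_exp:
  fixes m :: real
  assumes "0 < m"
  shows "square_integrable {..<a} (\<lambda>x. exp ((x - a) / m))"
proof -
  have "set_integrable lebesgue {0..} (\<lambda>x::real. exp (- (2 / m) * x))"
    using assms by (intro nonnegative_absolutely_integrable_1 integrable_on_exp_minus_to_infinity) auto
  then have "set_integrable lborel {0..} (\<lambda>x::real. exp (- (2 / m) * x))"
    unfolding set_integrable_def
    by (subst (asm) integrable_completion)
      (auto intro!: borel_measurable_continuous_on_indicator continuous_intros)
  then have "integrable lborel
      (\<lambda>x. indicator {0..} (a + (- 1) * x) *\<^sub>R exp (- (2 / m) * (a + (- 1) * x)) :: real)"
    unfolding set_integrable_def by (rule lborel_integrable_real_affine) simp
  moreover have "indicator {0..} (a + (- 1) * x) *\<^sub>R exp (- (2 / m) * (a + (- 1) * x))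
      = indicator {..a} x *\<^sub>R (exp ((x - a) / m))\<^sup>2" for x :: real
  proof -
    have "exp (- (2 / m) * (a + (- 1) * x)) = (exp ((x - a) / m))\<^sup>2"
      unfolding exp_double[symmetric] using assms by (intro arg_cong[where f=exp]) (simp add: field_simps)
    then show ?thesis
      by (simp only:) (simp add: indicator_def)
  qed
  ultimately have "set_integrable lborel {..a} (\<lambda>x. (exp ((x - a) / m))\<^sup>2)"
    by (simp add: set_integrable_def)
  then show ?thesis
    by (simp add: square_integrable_def set_integrable_atMost_iff_lessThan)
qed

text \<open>On a unit interval the integral of \<open>((y - x + 1) f\<^sup>2)'\<close> bounds \<open>f\<^sup>2(x)\<close> by a tail of
  \<open>\<integral> 2 f\<^sup>2 + f'\<^sup>2\<close>.\<close>

lemma square_integrable_tendsto_0: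
  fixes f f' :: "real \<Rightarrow> real"
  assumes der: "\<And>x. x \<le> a \<Longrightarrow> (f has_real_derivative f' x) (at x within {..a})"
    and cont: "continuous_on {..a} f'"
    and int: "square_integrable {..<a} f" "square_integrable {..<a} f'"
  shows "(f \<longlongrightarrow> 0) at_bot"
proof -
  define k where "k = (\<lambda>x. 2 * (f x)\<^sup>2 + (f' x)\<^sup>2)"
  have contf: "continuous_on {..a} f"
    using der by (auto simp: continuous_on_eq_continuous_within intro: DERIV_continuous)
  have contk: "continuous_on {..a} k"
    unfolding k_def using contf cont by (intro continuous_intros)
  have intk: "set_integrable lborel {..a} k"
    unfolding set_integrable_atMost_iff_lessThan k_def using int unfolding square_integrable_def
    by (intro set_integral_add set_integrable_mult_right) auto
  have k_Icc: "integral {x..y} k = set_lebesgue_integral lborel {x..y} k" if "y \<le> a" for x y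
    using that contk
    by (intro set_borel_integral_eq_integral(2)[symmetric] borel_integrable_atLeastAtMost')
      (auto intro: continuous_on_subset)
  \<comment> \<open>\<open>K\<close> has a finite limit at minus infinity because \<open>k\<close>
    is integrable, and so does its unit shift. Their difference, the integral of \<open>k\<close>
    over a unit interval, therefore tends to 0.\<close>
  define K where "K = (\<lambda>x. integral {x..a} k)"
  have limK: "(K \<longlongrightarrow> set_lebesgue_integral lborel {..a} k) at_bot"
    unfolding K_def k_Icc[OF order_refl]
    using intk by (intro tendsto_set_lebesgue_integral_at_bot) auto
  moreover have "filterlim (\<lambda>x::real. x - 1) at_bot at_bot"
    unfolding filterlim_at_bot eventually_at_bot_linorder
    by (metis add_le_cancel_right diff_add_cancel)
  then have limK': "((\<lambda>x. K (x - 1)) \<longlongrightarrow> set_lebesgue_integral lborel {..a} k) at_bot"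
    by (rule filterlim_compose[OF limK])
  ultimately have lim: "((\<lambda>x. K (x - 1) - K x) \<longlongrightarrow> 0) at_bot"
    using tendsto_diff by fastforce
  have bound: "(f x)\<^sup>2 \<le> K (x - 1) - K x" if "x \<le> a" for x
  proof -
    let ?g' = "\<lambda>y. (f y)\<^sup>2 + (y - x + 1) * (2 * f y * f' y)"
    have ftc: "(?g' has_integral (x - x + 1) * (f x)\<^sup>2 - (x - 1 - x + 1) * (f (x - 1))\<^sup>2) {x - 1..x}"
    proof (rule fundamental_theorem_of_calculus)
      fix y assume y: "y \<in> {x - 1..x}"
      have "(f has_real_derivative f' y) (at y within {x - 1..x})"
        using der[of y] y that by (auto intro: has_field_derivative_subset)
      then show "((\<lambda>y. (y - x + 1) * (f y)\<^sup>2) has_vector_derivative ?g' y) (at y within {x - 1..x})"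
        unfolding has_real_derivative_iff_has_vector_derivative[symmetric]
        by (auto intro!: derivative_eq_intros simp: algebra_simps)
    qed simp
    have k_int: "k integrable_on {u..v}" if "v \<le> a" for u v
      using that by (intro integrable_continuous_real continuous_on_subset[OF contk]) auto
    have "(f x)\<^sup>2 = integral {x - 1..x} ?g'"
      using integral_unique[OF ftc] by simp
    also have "\<dots> \<le> integral {x - 1..x} k"
    proof (rule integral_le)
      show "?g' integrable_on {x - 1..x}" using ftc by blast
      show "k integrable_on {x - 1..x}" using k_int that by blast
      fix y assume y: "y \<in> {x - 1..x}"
      have "(y - x + 1) * (2 * f y * f' y) \<le> 1 * ((f y)\<^sup>2 + (f' y)\<^sup>2)"
      proof -
        have "(y - x + 1) * (2 * f y * f' y) \<le> (y - x + 1) * ((f y)\<^sup>2 + (f' y)\<^sup>2)"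
          using y sum_squares_bound[of "f y" "f' y"] by (intro mult_left_mono) auto
        also have "\<dots> \<le> 1 * ((f y)\<^sup>2 + (f' y)\<^sup>2)"
          using y by (intro mult_right_mono) auto
        finally show ?thesis .
      qed
      then show "?g' y \<le> k y" by (simp add: k_def)
    qed
    also have "\<dots> = K (x - 1) - K x"
      unfolding K_def
      using Henstock_Kurzweil_Integration.integral_combine[of "x - 1" x a k] that k_int by simp
    finally show ?thesis .
  qed
  have "((\<lambda>x. (f x)\<^sup>2) \<longlongrightarrow> 0) at_bot"
    by (rule tendsto_sandwich[OF _ _ tendsto_const lim])
      (use bound in \<open>auto simp: eventually_at_bot_linorder\<close>)
  then show ?thesis
    using tendsto_rabs_zero_iff tendsto_real_sqrt[of "\<lambda>x. (f x)\<^sup>2" 0 at_bot] by auto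
qed

subsection \<open>The operator \<open>R\<^sub>1\<close> and its boundary value\<close>

text \<open>Replaces the nested \<open>vector_derivative\<close> terms by witnesses, so that
  membership can be checked by exhibiting the two derivatives.\<close>

lemma is_R1_iff:
  "is_R1 p v u \<longleftrightarrow> (\<exists>u1 u2. (\<forall>x\<le>- rad p. (u has_real_derivative u1 x) (at x within {..- rad p})) \<and>
     (\<forall>x\<le>- rad p. (u1 has_real_derivative u2 x) (at x within {..- rad p})) \<and>
     continuous_on {..- rad p} u2 \<and>
     square_integrable {..<- rad p} u \<and> square_integrable {..<- rad p} u1 \<and>
     square_integrable {..<- rad p} u2 \<and>
     (\<forall>x < - rad p. u x - (mut p)\<^sup>2 * u2 x = v x) \<and> (u1 \<longlongrightarrow> 0) at_bot \<and> u1 (- rad p) = 0)"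
  (is "_ = (\<exists>u1 u2. ?R u1 u2)")
proof -
  let ?a = "- rad p"
  define d1 where "d1 = (\<lambda>x. vector_derivative u (at x within {..?a}))"
  define d2 where "d2 = (\<lambda>x. vector_derivative d1 (at x within {..?a}))"
  have def: "is_R1 p v u \<longleftrightarrow> u differentiable_on {..?a} \<and> d1 differentiable_on {..?a} \<and>
     continuous_on {..?a} d2 \<and> square_integrable {..<?a} u \<and> square_integrable {..<?a} d1 \<and>
     square_integrable {..<?a} d2 \<and> (\<forall>x < ?a. u x - (mut p)\<^sup>2 * d2 x = v x) \<and>
     (d1 \<longlongrightarrow> 0) at_bot \<and> d1 ?a = 0"
    unfolding is_R1_def Let_def dom_minus_def closure_lessThan d2_def d1_def by auto
  show ?thesis
  proof
    assume "is_R1 p v u"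
    then have "?R d1 d2"
      unfolding def
      by (auto simp: differentiable_on_def d1_def d2_def
          intro!: has_real_derivative_vector_derivative_within)
    then show "\<exists>u1 u2. ?R u1 u2" by blast
  next
    assume "\<exists>u1 u2. ?R u1 u2"
    then obtain u1 u2 where R: "?R u1 u2" by blast
    have e1: "d1 x = u1 x" if "x \<le> ?a" for x
      unfolding d1_def using R that
      by (intro vector_derivative_within_eq_real at_within_atMost_neq_bot) auto
    have der1: "(d1 has_real_derivative u2 x) (at x within {..?a})" if "x \<le> ?a" for x
      by (rule has_real_derivative_within_cong[of u1]) (use R that e1 in auto)
    have e2: "d2 x = u2 x" if "x \<le> ?a" for x
      unfolding d2_def using der1 that
      by (intro vector_derivative_within_eq_real at_within_atMost_neq_bot) auto
    have "u differentiable_on {..?a}" "d1 differentiable_on {..?a}"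
      using R der1 unfolding differentiable_on_def by (auto simp: real_differentiable_def)
    moreover have "continuous_on {..?a} d2"
      using R e2 continuous_on_cong[of "{..?a}" "{..?a}" d2 u2] by simp
    moreover have "square_integrable {..<?a} d1" "square_integrable {..<?a} d2"
      using R e1 e2 square_integrable_cong[of ?a d1 u1] square_integrable_cong[of ?a d2 u2] by auto
    moreover have "(d1 \<longlongrightarrow> 0) at_bot"
    proof (rule Lim_transform_eventually)
      show "(u1 \<longlongrightarrow> 0) at_bot" using R by blast
      show "\<forall>\<^sub>F x in at_bot. u1 x = d1 x"
        by (rule eventually_mono[OF eventually_le_at_bot[of ?a]]) (simp add: e1)
    qed
    ultimately show "is_R1 p v u"
      unfolding def using R e1 e2 by auto
  qed
qed

text \<open>The difference \<open>d\<close> of two solutions satisfies \<open>d = m^2 d''\<close>.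
  Factoring the operator, \<open>d + m d'\<close> is a multiple of \<open>exp (x / m)\<close> and
  \<open>d - m d'\<close> a multiple of \<open>exp (- x / m)\<close>. The condition at minus
  infinity kills the second constant, and then the Neumann condition at \<open>-r\<close> kills the
  first.\<close>

lemma is_R1_unique:
  assumes m: "0 < mut p" and u: "is_R1 p v u" and w: "is_R1 p v w" and x: "x \<le> - rad p"
  shows "u x = w x"
proof -
  let ?a = "- rad p" and ?m = "mut p"
  obtain u1 u2 w1 w2 where
    u': "\<And>x. x \<le> ?a \<Longrightarrow> (u has_real_derivative u1 x) (at x within {..?a})"
    "\<And>x. x \<le> ?a \<Longrightarrow> (u1 has_real_derivative u2 x) (at x within {..?a})"
    "continuous_on {..?a} u2" "\<And>x. x < ?a \<Longrightarrow> u x - ?m\<^sup>2 * u2 x = v x" "(u1 \<longlongrightarrow> 0) at_bot" "u1 ?a = 0"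
  and w':
    "\<And>x. x \<le> ?a \<Longrightarrow> (w has_real_derivative w1 x) (at x within {..?a})"
    "\<And>x. x \<le> ?a \<Longrightarrow> (w1 has_real_derivative w2 x) (at x within {..?a})"
    "continuous_on {..?a} w2" "\<And>x. x < ?a \<Longrightarrow> w x - ?m\<^sup>2 * w2 x = v x" "(w1 \<longlongrightarrow> 0) at_bot" "w1 ?a = 0"
    using u w unfolding is_R1_iff by blast
  define d where "d = (\<lambda>x. u x - w x)"
  define d1 where "d1 = (\<lambda>x. u1 x - w1 x)"
  define d2 where "d2 = (\<lambda>x. u2 x - w2 x)"
  have d: "(d has_real_derivative d1 x) (at x within {..?a})" if "x \<le> ?a" for x
    unfolding d_def d1_def using that by (intro derivative_intros u' w')
  have d1: "(d1 has_real_derivative d2 x) (at x within {..?a})" if "x \<le> ?a" for x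
    unfolding d2_def d1_def using that by (intro derivative_intros u' w')
  have contd: "continuous_on {..?a} d"
    using d by (auto simp: continuous_on_eq_continuous_within intro: DERIV_continuous)
  have eq: "d x = ?m\<^sup>2 * d2 x" if "x \<le> ?a" for x
  proof -
    have "d x - ?m\<^sup>2 * d2 x = 0"
    proof (rule zero_on_atMost[where f="\<lambda>x. d x - ?m\<^sup>2 * d2 x" and x=x])
      show "continuous_on {..?a} (\<lambda>x. d x - ?m\<^sup>2 * d2 x)"
        unfolding d2_def using u' w' contd by (intro continuous_intros)
      show "d y - ?m\<^sup>2 * d2 y = 0" if "y < ?a" for y
        using u'(4)[OF that] w'(4)[OF that] by (simp add: d_def d2_def algebra_simps)
    qed (use that in auto)
    then show ?thesis by simp
  qed
  have "\<exists>C. \<forall>x\<in>{..?a}. (d x + ?m * d1 x) * exp (- x / ?m) = C"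
  proof (rule has_field_derivative_zero_constant)
    fix x assume "x \<in> {..?a}"
    then show "((\<lambda>x. (d x + ?m * d1 x) * exp (- x / ?m)) has_real_derivative 0) (at x within {..?a})"
      using m by (auto intro!: derivative_eq_intros d d1 simp: eq field_simps power2_eq_square)
  qed simp
  then obtain C where C: "(d x + ?m * d1 x) * exp (- x / ?m) = C" if "x \<le> ?a" for x
    by auto
  have "\<exists>C. \<forall>x\<in>{..?a}. (d x - ?m * d1 x) * exp (x / ?m) = C"
  proof (rule has_field_derivative_zero_constant)
    fix x assume "x \<in> {..?a}"
    then show "((\<lambda>x. (d x - ?m * d1 x) * exp (x / ?m)) has_real_derivative 0) (at x within {..?a})"
      using m by (auto intro!: derivative_eq_intros d d1 simp: eq field_simps power2_eq_square)
  qed simp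
  then obtain K where K: "(d x - ?m * d1 x) * exp (x / ?m) = K" if "x \<le> ?a" for x
    by auto
  \<comment> \<open>Eliminating \<open>d\<close> between the two invariants leaves an expression in
    \<open>d1\<close>, whose limit at minus infinity is known.\<close>
  have Ke: "K = C * exp (x / ?m) * exp (x / ?m) - 2 * ?m * d1 x * exp (x / ?m)" if "x \<le> ?a" for x
  proof -
    have "C * exp (x / ?m) = d x + ?m * d1 x"
      using C[OF that] by (auto simp: exp_minus field_simps)
    then show ?thesis
      using K[OF that] by (simp add: algebra_simps)
  qed
  have "filterlim (\<lambda>x. x / ?m) at_bot at_bot"
    using m by (simp add: filterlim_at_bot eventually_at_bot_linorder field_simps)
  then have lim: "((\<lambda>x. exp (x / ?m)) \<longlongrightarrow> 0) at_bot"
    by (rule filterlim_compose[OF exp_at_bot])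
  have limd1: "(d1 \<longlongrightarrow> 0) at_bot"
    unfolding d1_def using tendsto_diff[OF u'(5) w'(5)] by simp
  have "((\<lambda>x. C * exp (x / ?m) * exp (x / ?m) - 2 * ?m * d1 x * exp (x / ?m))
      \<longlongrightarrow> C * 0 * 0 - 2 * ?m * 0 * 0) at_bot"
    by (intro tendsto_intros lim limd1)
  moreover have "\<forall>\<^sub>F x in at_bot. C * exp (x / ?m) * exp (x / ?m) - 2 * ?m * d1 x * exp (x / ?m) = K"
    using Ke by (auto simp: eventually_at_bot_linorder)
  ultimately have "((\<lambda>x::real. K) \<longlongrightarrow> 0) at_bot"
    using Lim_transform_eventually by fastforce
  then have "K = 0"
    by (rule tendsto_unique[OF trivial_limit_at_bot_linorder tendsto_const])
  have "d1 ?a = 0"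
    using u' w' by (simp add: d1_def)
  then have "C = 0"
    using Ke[of ?a] \<open>K = 0\<close> by simp
  have "d x = 0"
    using C[OF x] K[OF x] \<open>C = 0\<close> \<open>K = 0\<close> by simp
  then show ?thesis
    by (simp add: d_def)
qed

lemma R1_eqI:
  assumes m: "0 < mut p" and u: "is_R1 p v u" and x: "x \<le> - rad p"
  shows "R1 p v x = u x"
proof -
  let ?a = "- rad p"
  \<comment> \<open>\<open>R1\<close> is normalised to vanish off the closed half line. Truncating
    \<open>u\<close> accordingly does not affect derivatives taken within that half line.\<close>
  define u0 where "u0 = (\<lambda>x. if x \<le> ?a then u x else 0)"
  obtain u1 u2 where R:
    "\<forall>x\<le>?a. (u has_real_derivative u1 x) (at x within {..?a})"
    "\<forall>x\<le>?a. (u1 has_real_derivative u2 x) (at x within {..?a})"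
    "continuous_on {..?a} u2" "square_integrable {..<?a} u" "square_integrable {..<?a} u1"
    "square_integrable {..<?a} u2" "\<forall>x < ?a. u x - (mut p)\<^sup>2 * u2 x = v x" "(u1 \<longlongrightarrow> 0) at_bot" "u1 ?a = 0"
    using u unfolding is_R1_iff by blast
  have "square_integrable {..<?a} u0"
    using R(4) square_integrable_cong[of ?a u0 u] by (auto simp: u0_def)
  moreover have "(u0 has_real_derivative u1 x) (at x within {..?a})" if "x \<le> ?a" for x
    by (rule has_real_derivative_within_cong[of u]) (use R that in \<open>auto simp: u0_def\<close>)
  ultimately have u0: "is_R1 p v u0"
    unfolding is_R1_iff using R by (intro exI[of _ u1] exI[of _ u2]) (auto simp: u0_def)
  have "R1 p v = u0"
    unfolding R1_def
  proof (rule the_equality)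
    fix w assume w: "is_R1 p v w \<and> (\<forall>x. x \<notin> closure (dom_minus p) \<longrightarrow> w x = 0)"
    show "w = u0"
    proof
      fix x show "w x = u0 x"
        using w is_R1_unique[OF m _ u0, of w x] by (auto simp: u0_def dom_minus_def)
    qed
  qed (use u0 in \<open>auto simp: u0_def dom_minus_def\<close>)
  then show ?thesis
    using x by (simp add: u0_def)
qed

lemma R1_boundary_value:
  fixes \<phi> w w1 w2 :: "real \<Rightarrow> real"
  assumes m: "0 < mut p"
    and w: "\<And>x. x \<le> - rad p \<Longrightarrow> (w has_real_derivative w1 x) (at x within {..- rad p})"
    and w1: "\<And>x. x \<le> - rad p \<Longrightarrow> (w1 has_real_derivative w2 x) (at x within {..- rad p})"
    and \<phi>: "\<And>x. x \<le> - rad p \<Longrightarrow>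
      (\<phi> has_real_derivative (mut p)\<^sup>2 * w2 x - w x) (at x within {..- rad p})"
    and int: "square_integrable {..<- rad p} \<phi>" "square_integrable {..<- rad p} w"
      "square_integrable {..<- rad p} w1"
  shows "R1 p \<phi> (- rad p) = \<phi> (- rad p) - (mut p)\<^sup>2 * w1 (- rad p) + mut p * w (- rad p)"
proof -
  let ?a = "- rad p" and ?m = "mut p"
  \<comment> \<open>\<open>E\<close> solves the homogeneous equation, decays at minus infinity and
    equals 1 at \<open>-r\<close>. Its coefficient in \<open>U\<close> is chosen so that
    \<open>U1\<close> vanishes at \<open>-r\<close>.\<close>
  define E where "E = (\<lambda>x. exp ((x - ?a) / ?m))"
  define U where "U = (\<lambda>x. (\<phi> x + (- ?m\<^sup>2) * w1 x) + ?m * w ?a * E x)"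
  define U1 where "U1 = (\<lambda>x. (- 1) * w x + w ?a * E x)"
  define U2 where "U2 = (\<lambda>x. (- 1) * w1 x + w ?a / ?m * E x)"
  have E: "(E has_real_derivative E x / ?m) (at x within S)" for x S
    unfolding E_def using m by (auto intro!: derivative_eq_intros)
  have contw: "continuous_on {..?a} w" "continuous_on {..?a} w1" "continuous_on {..?a} \<phi>"
    "continuous_on {..?a} E"
    using w w1 \<phi> DERIV_continuous[OF E] by (auto simp: continuous_on_eq_continuous_within intro: DERIV_continuous)
  have intE: "square_integrable {..<?a} E"
    unfolding E_def by (rule square_integrable_exp[OF m])
  \<comment> \<open>The derivative of \<open>U\<close> combines \<open>w\<close> and
    \<open>E\<close>. Both tend to 0 because they and their derivatives are square
    integrable.\<close>
  have E0: "(E \<longlongrightarrow> 0) at_bot"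
  proof (rule square_integrable_tendsto_0[where a="?a" and f'="\<lambda>x. 1 / ?m * E x"])
    show "(E has_real_derivative 1 / ?m * E x) (at x within {..?a})" for x
      using E by simp
  qed (intro continuous_intros square_integrable_cmult intE contw)+
  have w0: "(w \<longlongrightarrow> 0) at_bot"
    by (rule square_integrable_tendsto_0[where a="?a" and f'=w1]) (use w contw int in auto)
  have "is_R1 p \<phi> U"
    unfolding is_R1_iff
  proof (rule exI[of _ U1], rule exI[of _ U2], intro conjI allI impI)
    fix x assume x: "x \<le> ?a"
    show "(U has_real_derivative U1 x) (at x within {..?a})"
      unfolding U_def U1_def using m x
      by (auto intro!: derivative_eq_intros \<phi> w1 E simp: field_simps)
    show "(U1 has_real_derivative U2 x) (at x within {..?a})"
      unfolding U1_def U2_def using m x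
      by (auto intro!: derivative_eq_intros w E simp: field_simps)
  next
    show "continuous_on {..?a} U2"
      unfolding U2_def by (intro continuous_intros contw)
    show "square_integrable {..<?a} U" "square_integrable {..<?a} U1" "square_integrable {..<?a} U2"
      unfolding U_def U1_def U2_def
      by (intro square_integrable_add square_integrable_cmult int intE continuous_intros contw)+
    show "U x - ?m\<^sup>2 * U2 x = \<phi> x" for x
      using m by (simp add: U_def U2_def field_simps power2_eq_square)
    show "(U1 \<longlongrightarrow> 0) at_bot"
      unfolding U1_def using tendsto_add[OF tendsto_mult_left[OF w0, of "- 1"] tendsto_mult_left[OF E0, of "w ?a"]]
      by simp
    show "U1 ?a = 0"
      by (simp add: U1_def E_def)
  qed
  then have "R1 p \<phi> ?a = U ?a"
    by (rule R1_eqI[OF m]) simp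
  then show ?thesis
    by (simp add: U_def E_def)
qed

section \<open>The exterior momentum equation and the boundary value of \<open>R1\<close> applied to
  \<open>phi\<close>\<close>

lemma cont_txD:
  assumes "cont_tx J X f" "t \<in> J"
  shows "continuous_on (closure X) (f t)"
proof -
  have "continuous_on (closure X) (\<lambda>x. case (t, x) of (t, x) \<Rightarrow> f t x)"
    by (rule continuous_on_compose2[OF assms(1)[unfolded cont_tx_def]])
      (use assms(2) in \<open>auto intro!: continuous_on_Pair continuous_on_const continuous_on_id\<close>)
  then show ?thesis by simp
qed

lemma C1_x_has_derivative:
  "C1_x J X f \<Longrightarrow> t \<in> J \<Longrightarrow> x \<in> closure X \<Longrightarrow>
    (f t has_real_derivative dx X f t x) (at x within closure X)"
  unfolding C1_x_def dx_def differentiable_on_def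
  by (simp add: has_real_derivative_vector_derivative_within)

lemma dx_eq:
  "(f t has_real_derivative D) (at x within closure X) \<Longrightarrow> at x within closure X \<noteq> bot \<Longrightarrow>
    dx X f t x = D"
  unfolding dx_def by (rule vector_derivative_within_eq_real)

lemma C1_x_cont:
  assumes "C1_x J X f" "t \<in> J"
  shows "continuous_on (closure X) (f t)" "continuous_on (closure X) (dx X f t)"
  using assms by (auto simp: C1_x_def intro: cont_txD)

text \<open>The nonlinear terms of \<open>phi\<close> are controlled near minus infinity, where the
  far-field limits make each of them at most a multiple of \<open>z\<close> or \<open>q\<close>.
  This gives \<open>abs phi <= 2 abs z + 2 abs q\<close> there, and squaring produces the constant
  8.\<close>

lemma phi_square_integrable:
  assumes p: "0 < eps p" "eps p \<le> 1"
    and cont: "continuous_on {..a} (z t)" "continuous_on {..a} (q t)"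
    and h: "\<And>x. x \<le> a \<Longrightarrow> 0 < hgt p z t x"
    and int: "square_integrable {..<a} (z t)" "square_integrable {..<a} (q t)"
    and lim: "(z t \<longlongrightarrow> 0) at_bot" "(q t \<longlongrightarrow> 0) at_bot"
  shows "square_integrable {..<a} (phi p z q t)"
proof (rule square_integrable_eventually_bound)
  show "continuous_on {..a} (phi p z q t)"
    unfolding phi_def hgt_def
    using h by (intro continuous_intros cont) (auto simp: hgt_def dest: less_imp_neq[symmetric])
  show "set_integrable lborel {..<a} (\<lambda>x. 8 * (z t x)\<^sup>2 + 8 * (q t x)\<^sup>2)"
    using int unfolding square_integrable_def
    by (intro set_integral_add set_integrable_mult_right) auto
  \<comment> \<open>Since \<open>eps p <= 1\<close>, the first threshold keeps the height above
    \<open>1 / 2\<close>; the second makes the square of \<open>q\<close> at most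
    \<open>abs q\<close>.\<close>
  have ev: "\<forall>\<^sub>F x in at_bot. dist (z t x) 0 < 1 / 2" "\<forall>\<^sub>F x in at_bot. dist (q t x) 0 < 1"
    using tendstoD[OF lim(1), of "1 / 2"] tendstoD[OF lim(2), of 1] by auto
  show "\<forall>\<^sub>F x in at_bot. (phi p z q t x)\<^sup>2 \<le> 8 * (z t x)\<^sup>2 + 8 * (q t x)\<^sup>2"
    using ev
  proof eventually_elim
    case (elim x)
    have z: "\<bar>z t x\<bar> \<le> 1 / 2" and q: "\<bar>q t x\<bar> \<le> 1"
      using elim by auto
    have ez: "\<bar>eps p * z t x\<bar> \<le> 1 / 2"
      using mult_mono[of "eps p" 1 "\<bar>z t x\<bar>" "1 / 2"] p z by (simp add: abs_mult)
    have h2: "1 / 2 \<le> hgt p z t x"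
      using ez by (simp add: hgt_def abs_le_iff)
    have "\<bar>z t x + eps p * (z t x)\<^sup>2 / 2\<bar> = \<bar>z t x\<bar> * \<bar>1 + eps p * z t x / 2\<bar>"
      unfolding abs_mult[symmetric] by (simp add: algebra_simps power2_eq_square)
    also have "\<dots> \<le> \<bar>z t x\<bar> * 2"
      using ez by (intro mult_left_mono) auto
    finally have b1: "\<bar>z t x + eps p * (z t x)\<^sup>2 / 2\<bar> \<le> 2 * \<bar>z t x\<bar>" by simp
    have "\<bar>eps p * (q t x)\<^sup>2\<bar> = eps p * \<bar>q t x\<bar> * \<bar>q t x\<bar>"
      using p by (simp add: abs_mult power2_eq_square)
    also have "\<dots> \<le> 1 * 1 * \<bar>q t x\<bar>"
      using p q by (intro mult_right_mono mult_mono) auto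
    finally have "\<bar>eps p * (q t x)\<^sup>2\<bar> \<le> \<bar>q t x\<bar>" by simp
    then have "\<bar>eps p * (q t x)\<^sup>2 / hgt p z t x\<bar> \<le> 2 * \<bar>q t x\<bar>"
      using h2 frac_le[of "\<bar>q t x\<bar>" "\<bar>eps p * (q t x)\<^sup>2\<bar>" "1 / 2" "hgt p z t x"]
      by (simp add: abs_divide)
    then have "\<bar>phi p z q t x\<bar> \<le> 2 * \<bar>z t x\<bar> + 2 * \<bar>q t x\<bar>"
      using b1 abs_triangle_ineq[of "z t x + eps p * (z t x)\<^sup>2 / 2" "eps p * (q t x)\<^sup>2 / hgt p z t x"]
      unfolding phi_def by linarith
    then have "(phi p z q t x)\<^sup>2 \<le> (2 * \<bar>z t x\<bar> + 2 * \<bar>q t x\<bar>)\<^sup>2"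
      by (rule abs_le_square_iff[THEN iffD1, OF order_trans]) auto
    also have "\<dots> \<le> 8 * (z t x)\<^sup>2 + 8 * (q t x)\<^sup>2"
      using sum_squares_bound[of "\<bar>z t x\<bar>" "\<bar>q t x\<bar>"] by (simp add: power2_sum power_mult_distrib)
    finally show ?case .
  qed
qed

text \<open>The hydrostatic and convective terms form an exact derivative:
  \<open>h zeta' + eps (q^2 / h)'\<close> is \<open>phi'\<close>. The momentum equation thus becomes
  the derivative hypothesis of \<open>R1_boundary_value\<close> with
  \<open>w = dt J q t\<close>.\<close>

lemma R1_phi_boundary:
  assumes p: "0 < eps p" "eps p \<le> 1" "0 < mut p"
    and reg: "regular_wave J (dom_minus p) z q" and dec: "decaying J (dom_minus p) z q"
    and pos: "positive_height p J (dom_minus p) z" and far: "far_field J z q"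
    and mom: "\<And>x. x \<in> dom_minus p \<Longrightarrow> momentum_lhs p J (dom_minus p) z q t x = 0"
    and t: "t \<in> J"
  shows "R1 p (phi p z q t) (- rad p) = phi p z q t (- rad p)
    - (mut p)\<^sup>2 * dx (dom_minus p) (dt J q) t (- rad p) + mut p * dt J q t (- rad p)"
proof -
  let ?a = "- rad p" and ?X = "dom_minus p"
  have cl: "closure ?X = {..?a}" by (simp add: dom_minus_def)
  have C1: "C1_x J ?X z" "C1_x J ?X q" "C1_x J ?X (dt J q)" "C1_x J ?X (dx ?X (dt J q))"
    using reg by (auto simp: regular_wave_def C1_tx_def)
  note der = C1[THEN C1_x_has_derivative, OF t, unfolded cl]
  note cont = C1[THEN C1_x_cont(1), OF t, unfolded cl] C1[THEN C1_x_cont(2), OF t, unfolded cl]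
  define w where "w = dt J q t"
  define w2 where "w2 = dx ?X (dx ?X (dt J q)) t"
  define zx where "zx = dx ?X z t"
  define qx where "qx = dx ?X q t"
  define h where "h = hgt p z t"
  have h: "0 < h x" if "x \<le> ?a" for x
    using pos t that by (simp add: positive_height_def cl h_def)
  have contz: "continuous_on {..?a} (z t)" "continuous_on {..?a} (q t)" "continuous_on {..?a} zx"
    "continuous_on {..?a} qx" "continuous_on {..?a} w" "continuous_on {..?a} w2"
    using cont by (auto simp: w_def w2_def zx_def qx_def)
  have conth: "continuous_on {..?a} h"
    unfolding h_def hgt_def by (intro continuous_intros contz)
  have derz: "(z t has_real_derivative zx x) (at x within {..?a})"
    "(q t has_real_derivative qx x) (at x within {..?a})" if "x \<le> ?a" for x
    using der that by (auto simp: zx_def qx_def)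
  \<comment> \<open>The convective term written out by the quotient rule, so that its continuity up
    to \<open>-r\<close> follows from that of \<open>z\<close>, \<open>q\<close> and their first
    derivatives.\<close>
  define G where "G = (\<lambda>x. eps p * ((2 * q t x * qx x * h x - (q t x)\<^sup>2 * (eps p * zx x)) / (h x)\<^sup>2))"
  have derq: "((\<lambda>y. (q t y)\<^sup>2 / hgt p z t y) has_real_derivative G x / eps p) (at x within {..?a})"
    if "x \<le> ?a" for x
  proof -
    have "(h has_real_derivative eps p * zx x) (at x within {..?a})"
      unfolding h_def hgt_def using that by (auto intro!: derivative_eq_intros derz)
    then have "((\<lambda>y. (q t y)\<^sup>2 / h y) has_real_derivative
        (2 * q t x * qx x * h x - (q t x)\<^sup>2 * (eps p * zx x)) / (h x * h x)) (at x within {..?a})"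
      using that h[OF that] by (auto intro!: derivative_eq_intros derz)
    then show ?thesis
      using p by (simp add: G_def h_def power2_eq_square)
  qed
  have zero: "w x - (mut p)\<^sup>2 * w2 x + G x + h x * zx x = 0" if "x \<le> ?a" for x
  proof (rule zero_on_atMost[where
        f="\<lambda>x. w x - (mut p)\<^sup>2 * w2 x + G x + h x * zx x" and x=x])
    show "continuous_on {..?a} (\<lambda>x. w x - (mut p)\<^sup>2 * w2 x + G x + h x * zx x)"
      unfolding G_def using h
      by (intro continuous_intros contz conth) (auto dest: less_imp_neq[symmetric])
    fix y assume y: "y < ?a"
    have "dx ?X (\<lambda>s y. (q s y)\<^sup>2 / hgt p z s y) t y = G y / eps p"
      using derq[of y] y by (intro dx_eq) (auto simp: cl at_within_atMost_neq_bot)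
    then show "w y - (mut p)\<^sup>2 * w2 y + G y + h y * zx y = 0"
      using mom[of y] y p by (simp add: momentum_lhs_def dom_minus_def[of p] w_def w2_def zx_def h_def)
  qed (use that in auto)
  have "(phi p z q t has_real_derivative (mut p)\<^sup>2 * w2 x - w x) (at x within {..?a})"
    if "x \<le> ?a" for x
  proof -
    define Q where "Q = (\<lambda>y. (q t y)\<^sup>2 / hgt p z t y)"
    have "(Q has_real_derivative G x / eps p) (at x within {..?a})"
      unfolding Q_def by (rule derq[OF that])
    then have "((\<lambda>y. z t y + eps p * (z t y)\<^sup>2 / 2 + eps p * Q y) has_real_derivative
        zx x + eps p * (2 * z t x * zx x) / 2 + eps p * (G x / eps p)) (at x within {..?a})"
      using that by (auto intro!: derivative_eq_intros derz)
    moreover have "zx x + eps p * (2 * z t x * zx x) / 2 + eps p * (G x / eps p)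
        = (mut p)\<^sup>2 * w2 x - w x"
      using zero[OF that] p by (simp add: h_def hgt_def algebra_simps)
    ultimately show ?thesis
      by (simp add: phi_def[abs_def] Q_def)
  qed
  moreover have "square_integrable {..<?a} (phi p z q t)"
    using p pos dec far t contz
    by (intro phi_square_integrable)
      (auto simp: decaying_def far_field_def positive_height_def dom_minus_def)
  moreover have "square_integrable {..<?a} w" "square_integrable {..<?a} (dx ?X (dt J q) t)"
    using dec t by (auto simp: decaying_def dom_minus_def w_def)
  moreover have "(w has_real_derivative dx ?X (dt J q) t x) (at x within {..?a})"
    "(dx ?X (dt J q) t has_real_derivative w2 x) (at x within {..?a})" if "x \<le> ?a" for x
    using der that by (auto simp: w_def w2_def)
  ultimately have "R1 p (phi p z q t) ?a
      = phi p z q t ?a - (mut p)\<^sup>2 * dx ?X (dt J q) t ?a + mut p * w ?a"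
    by (intro R1_boundary_value[OF p(3)])
  then show ?thesis
    unfolding w_def .
qed

section \<open>Time derivatives and the trace form of the spring equation\<close>

lemma C2_time_has_derivative:
  assumes "C2_time J f" "t \<in> J"
  shows "(f has_real_derivative ddt J f t) (at t within J)"
    and "(ddt J f has_real_derivative ddt J (ddt J f) t) (at t within J)"
proof -
  have "f differentiable (at t within J)" "ddt J f differentiable (at t within J)"
    using assms by (auto simp: C2_time_def differentiable_on_def)
  from this[THEN has_real_derivative_vector_derivative_within]
  show "(f has_real_derivative ddt J f t) (at t within J)"
    "(ddt J f has_real_derivative ddt J (ddt J f) t) (at t within J)"
    unfolding ddt_def[of J f t] ddt_def[of J "ddt J f" t] .
qed

lemma time_interval_at_within_neq_bot:
  assumes "time_interval J" "t \<in> J"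
  shows "at t within J \<noteq> bot"
proof -
  have J: "is_interval J" "0 \<in> J" "J \<noteq> {0}"
    using assms by (simp_all add: time_interval_def)
  obtain s where "s \<in> J" "s \<noteq> t"
  proof (cases "t = 0")
    case True
    then show ?thesis using J that by blast
  next
    case False
    then show ?thesis using J that[of 0] by simp
  qed
  then show ?thesis
    by (rule at_within_interval_neq_bot[OF J(1) assms(2)])
qed

lemma dt_eq:
  assumes "\<And>s. s \<in> J \<Longrightarrow> f s x = g s" "(g has_real_derivative D) (at t within J)"
    and "time_interval J" "t \<in> J"
  shows "dt J f t x = D"
  unfolding dt_def
proof (rule vector_derivative_within_eq_real)
  show "((\<lambda>s. f s x) has_real_derivative D) (at t within J)"
    by (rule has_real_derivative_within_cong[OF assms(2,4)]) (simp add: assms(1))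
qed (rule time_interval_at_within_neq_bot[OF assms(3,4)])

text \<open>Both regimes \<open>\<mu> = 0\<close> and \<open>\<mu> \<noteq> 0\<close> of the spring equation are one and the same equation
  once the nonlocal boundary value of \<open>R\<^sub>1\<phi>\<close> is traded for the trace of \<open>\<partial>\<^sub>x\<partial>\<^sub>tq\<close>.\<close>

definition spring_mass_trace_ode :: "params \<Rightarrow> real set \<Rightarrow>
    (real \<Rightarrow> real \<Rightarrow> real) \<Rightarrow> (real \<Rightarrow> real \<Rightarrow> real) \<Rightarrow> (real \<Rightarrow> real) \<Rightarrow> bool" where
  "spring_mass_trace_ode p J z q zb \<longleftrightarrow> (\<forall>t\<in>J.
     let hb = hgt p z t (- rad p); hc = h_wc p (zb t) in
     (calT_sq p hc + (mut p)\<^sup>2 / hc) * ddt J (ddt J zb) t =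
       - (1 + P0 p) * zb t + kappa p * P0 p * memory p zb t
       + eps p * beta p hb hc * (ddt J zb t)\<^sup>2 + z t (- rad p)
       - (mut p)\<^sup>2 * dx (dom_minus p) (dt J q) t (- rad p) / hb)"

text \<open>For \<open>mut p = 0\<close> the trace terms vanish and the two forms coincide
  literally. Otherwise the boundary value of \<open>R1\<close> is inserted into \<open>calF\<close>.
  Its acceleration part accounts for the extra inertia in \<open>calT_mu_sq\<close>, its quadratic
  part for the opposite sign of the \<open>hb\<close> term in \<open>beta_mu\<close>.\<close>

lemma spring_mass_trace_ode_iff:
  assumes p: "0 < eps p" "eps p \<le> 1" "0 \<le> mut p" and J: "time_interval J"
    and reg: "regular_wave J (dom_minus p) z q" and dec: "decaying J (dom_minus p) z q"
    and pos: "positive_height p J (dom_minus p) z" and far: "far_field J z q"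
    and mom: "\<forall>t\<in>J. \<forall>x\<in>dom_minus p. momentum_lhs p J (dom_minus p) z q t x = 0"
    and C2: "C2_time J zb" and bc: "\<forall>t\<in>J. q t (- rad p) = ddt J zb t * len_plus p"
  shows "(mut p = 0 \<longrightarrow> spring_mass_ode p J z zb) \<and> (mut p \<noteq> 0 \<longrightarrow> spring_mass_ode_mu p J z q zb)
    \<longleftrightarrow> spring_mass_trace_ode p J z q zb"
proof (cases "mut p = 0")
  case True
  then show ?thesis
    by (simp add: spring_mass_ode_def spring_mass_trace_ode_def)
next
  case False
  then have m: "0 < mut p" using p by simp
  have "(let hb = hgt p z t (- rad p); hc = h_wc p (zb t) in
     calT_mu_sq p hb hc * ddt J (ddt J zb) t =
       - (1 + P0 p) * zb t + kappa p * P0 p * memory p zb t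
       + eps p * beta_mu p hb hc * (ddt J zb t)\<^sup>2 + calF p z q t (- rad p))
    \<longleftrightarrow> (let hb = hgt p z t (- rad p); hc = h_wc p (zb t) in
     (calT_sq p hc + (mut p)\<^sup>2 / hc) * ddt J (ddt J zb) t =
       - (1 + P0 p) * zb t + kappa p * P0 p * memory p zb t
       + eps p * beta p hb hc * (ddt J zb t)\<^sup>2 + z t (- rad p)
       - (mut p)\<^sup>2 * dx (dom_minus p) (dt J q) t (- rad p) / hb)" if t: "t \<in> J" for t
  proof -
    define hb where "hb = hgt p z t (- rad p)"
    define hc where "hc = h_wc p (zb t)"
    define L where "L = len_plus p"
    define y where "y = ddt J zb t"
    define y' where "y' = ddt J (ddt J zb) t"
    define Z where "Z = z t (- rad p)"
    define w1 where "w1 = dx (dom_minus p) (dt J q) t (- rad p)"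
    have hb: "0 < hb"
      using pos t by (simp add: positive_height_def hb_def dom_minus_def)
    have hbZ: "hb = 1 + eps p * Z" by (simp add: hb_def hgt_def Z_def)
    \<comment> \<open>Differentiating the boundary condition in time turns the trace of
      \<open>dt J q\<close> into the acceleration of the column.\<close>
    have "dt J q t (- rad p) = y' * L"
      unfolding y'_def L_def using C2_time_has_derivative(2)[OF C2 t] bc
      by (intro dt_eq[OF _ _ J t, where g="\<lambda>s. ddt J zb s * len_plus p"])
        (auto intro!: derivative_eq_intros)
    then have "R1 p (phi p z q t) (- rad p)
        = phi p z q t (- rad p) - (mut p)\<^sup>2 * w1 + mut p * (y' * L)"
      using R1_phi_boundary[OF p(1,2) m reg dec pos far _ t] mom t by (simp add: w1_def)
    moreover have "phi p z q t (- rad p) = Z + eps p * Z\<^sup>2 / 2 + eps p * (y * L)\<^sup>2 / hb"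
      using bc t by (simp add: phi_def Z_def hb_def y_def L_def)
    ultimately have F: "calF p z q t (- rad p) = (eps p * Z\<^sup>2 / 2 + (Z + eps p * Z\<^sup>2 / 2
        + eps p * (y * L)\<^sup>2 / hb - (mut p)\<^sup>2 * w1 + mut p * (y' * L))) / hb"
      by (simp add: calF_def Z_def hb_def)
    \<comment> \<open>The two halves of \<open>eps Z^2\<close>, one from \<open>calF\<close> and one
      from \<open>phi\<close>, add up with \<open>Z\<close> to \<open>Z (1 + eps Z) = Z hb\<close>.
      Division by \<open>hb\<close> then leaves the plain trace \<open>Z\<close>.\<close>
    also have "\<dots> = (Z * hb + eps p * (y * L)\<^sup>2 / hb - (mut p)\<^sup>2 * w1 + mut p * (y' * L)) / hb"
      unfolding hbZ by (simp add: algebra_simps power2_eq_square)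
    also have "\<dots> = Z + eps p * L\<^sup>2 * y\<^sup>2 / hb\<^sup>2 - (mut p)\<^sup>2 * w1 / hb + mut p * L / hb * y'"
      using hb by (simp add: field_simps power2_eq_square)
    finally have F: "calF p z q t (- rad p)
      = Z + eps p * L\<^sup>2 * y\<^sup>2 / hb\<^sup>2 - (mut p)\<^sup>2 * w1 / hb + mut p * L / hb * y'" .
    have b: "eps p * beta p hb hc * y\<^sup>2 = eps p * beta_mu p hb hc * y\<^sup>2 + eps p * L\<^sup>2 * y\<^sup>2 / hb\<^sup>2"
      by (simp add: beta_def beta_mu_def L_def ring_distribs)
    have T: "calT_mu_sq p hb hc * y' = (calT_sq p hc + (mut p)\<^sup>2 / hc) * y' + mut p * L / hb * y'"
      by (simp add: calT_mu_sq_def L_def ring_distribs)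
    show ?thesis
      unfolding Let_def hb_def[symmetric] hc_def[symmetric] y'_def[symmetric] y_def[symmetric]
        Z_def[symmetric] w1_def[symmetric] F b T
      by (rule iffI) linarith+
  qed
  then show ?thesis
    using False by (simp add: spring_mass_ode_mu_def spring_mass_trace_ode_def)
qed

subsection \<open>Flows with affine discharge\<close>

lemma dx_eq_cong:
  assumes "\<And>y. y \<in> closure X \<Longrightarrow> f t y = g y"
    and "(g has_real_derivative D) (at x within closure X)"
    and "x \<in> closure X" "at x within closure X \<noteq> bot"
  shows "dx X f t x = D"
proof (rule dx_eq)
  show "(f t has_real_derivative D) (at x within closure X)"
    by (rule has_real_derivative_within_cong[OF assms(2,3)]) (simp add: assms(1))
qed fact

lemma continuous_on_Times_fst:
  "continuous_on A f \<Longrightarrow> continuous_on (A \<times> B) (\<lambda>x. f (fst x))"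
  by (rule continuous_on_compose2[of A f]) (auto intro: continuous_on_fst continuous_on_id)

lemma cont_tx_cong:
  assumes "cont_tx J X g" "\<And>t x. t \<in> J \<Longrightarrow> x \<in> closure X \<Longrightarrow> f t x = g t x"
  shows "cont_tx J X f"
proof -
  have "continuous_on (J \<times> closure X) (\<lambda>(t, x). f t x)
      \<longleftrightarrow> continuous_on (J \<times> closure X) (\<lambda>(t, x). g t x)"
    by (rule continuous_on_cong) (auto simp: assms(2))
  then show ?thesis
    using assms(1) by (simp add: cont_tx_def)
qed

lemma cont_tx_quadratic:
  assumes "continuous_on J a" "continuous_on J b" "continuous_on J e"
  shows "cont_tx J X (\<lambda>t x. a t + b t * x + e t * x\<^sup>2)"
  unfolding cont_tx_def split_def
  by (intro continuous_intros continuous_on_Times_fst assms)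

lemma cont_tx_trace:
  assumes "cont_tx J X f" "x \<in> closure X"
  shows "continuous_on J (\<lambda>t. f t x)"
proof -
  have "continuous_on J (\<lambda>t. case (t, x) of (t, x) \<Rightarrow> f t x)"
    by (rule continuous_on_compose2[OF assms(1)[unfolded cont_tx_def]])
      (use assms(2) in \<open>auto intro!: continuous_on_Pair continuous_on_const continuous_on_id\<close>)
  then show ?thesis by simp
qed

text \<open>All profiles in the interior and in the chamber have this form: constant elevation,
  affine discharge, affine interior pressure and quadratic chamber pressure.\<close>

lemma C1_x_quadratic:
  assumes nb: "\<And>x. x \<in> closure X \<Longrightarrow> at x within closure X \<noteq> bot"
    and f: "\<And>t x. t \<in> J \<Longrightarrow> x \<in> closure X \<Longrightarrow> f t x = a t + b t * x + e t * x\<^sup>2"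
    and cont: "continuous_on J a" "continuous_on J b" "continuous_on J e"
  shows "C1_x J X f"
    and "\<And>t x. t \<in> J \<Longrightarrow> x \<in> closure X \<Longrightarrow> dx X f t x = b t + 2 * e t * x"
proof -
  have der: "(f t has_real_derivative b t + 2 * e t * x) (at x within closure X)"
    if "t \<in> J" "x \<in> closure X" for t x
  proof (rule has_real_derivative_within_cong)
    show "((\<lambda>x. a t + b t * x + e t * x\<^sup>2) has_real_derivative b t + 2 * e t * x)
        (at x within closure X)"
      by (auto intro!: derivative_eq_intros)
  qed (use that f in auto)
  show dx: "dx X f t x = b t + 2 * e t * x" if "t \<in> J" "x \<in> closure X" for t x
    using der[OF that] nb[OF that(2)] by (rule dx_eq)
  show "C1_x J X f"
    unfolding C1_x_def
  proof (intro conjI ballI)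
    show "f t differentiable_on closure X" if "t \<in> J" for t
      using der[OF that] unfolding differentiable_on_def by (auto simp: real_differentiable_def)
    show "cont_tx J X f"
      using cont_tx_quadratic[OF cont] f by (rule cont_tx_cong)
    have "cont_tx J X (\<lambda>t x. b t + 2 * e t * x + 0 * x\<^sup>2)"
      by (intro cont_tx_quadratic continuous_intros cont)
    then show "cont_tx J X (dx X f)"
      by (rule cont_tx_cong) (simp add: dx)
  qed
qed

text \<open>Under the constraints the flow in the interior domain and in the chamber is of this form:
  the elevation depends on time only and the discharge is affine in \<open>x\<close>.\<close>

locale affine_flow =
  fixes J X :: "real set" and z q :: "real \<Rightarrow> real \<Rightarrow> real" and Z Z' c c' d d' :: "real \<Rightarrow> real"
  assumes J: "time_interval J"
    and nb: "\<And>x. x \<in> closure X \<Longrightarrow> at x within closure X \<noteq> bot"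
    and z: "\<And>t x. t \<in> J \<Longrightarrow> x \<in> closure X \<Longrightarrow> z t x = Z t"
    and q: "\<And>t x. t \<in> J \<Longrightarrow> x \<in> closure X \<Longrightarrow> q t x = c t + d t * x"
    and Z': "\<And>t. t \<in> J \<Longrightarrow> (Z has_real_derivative Z' t) (at t within J)"
    and c': "\<And>t. t \<in> J \<Longrightarrow> (c has_real_derivative c' t) (at t within J)"
    and d': "\<And>t. t \<in> J \<Longrightarrow> (d has_real_derivative d' t) (at t within J)"
    and cont: "continuous_on J Z'" "continuous_on J c'" "continuous_on J d'"
begin

lemma cont0: "continuous_on J Z" "continuous_on J c" "continuous_on J d"
  using Z' c' d' by (auto simp: continuous_on_eq_continuous_within intro: DERIV_continuous)

lemma dt_z: "t \<in> J \<Longrightarrow> x \<in> closure X \<Longrightarrow> dt J z t x = Z' t"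
  by (rule dt_eq[OF _ Z' J]) (auto simp: z)

lemma dt_q: "t \<in> J \<Longrightarrow> x \<in> closure X \<Longrightarrow> dt J q t x = c' t + d' t * x"
  by (rule dt_eq[OF _ _ J, where g="\<lambda>s. c s + d s * x"])
    (auto simp: q intro!: derivative_eq_intros c' d')

lemma C1_x_z: "C1_x J X z"
  and dx_z: "t \<in> J \<Longrightarrow> x \<in> closure X \<Longrightarrow> dx X z t x = 0"
  using C1_x_quadratic[OF nb, of J z Z "\<lambda>_. 0" "\<lambda>_. 0"] z cont0 by auto

lemma C1_x_q: "C1_x J X q"
  and dx_q: "t \<in> J \<Longrightarrow> x \<in> closure X \<Longrightarrow> dx X q t x = d t"
  using C1_x_quadratic[OF nb, of J q c d "\<lambda>_. 0"] q cont0 by auto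

lemma C1_x_dt_q: "C1_x J X (dt J q)"
  and dx_dt_q: "t \<in> J \<Longrightarrow> x \<in> closure X \<Longrightarrow> dx X (dt J q) t x = d' t"
  using C1_x_quadratic[OF nb, of J "dt J q" c' d' "\<lambda>_. 0"] dt_q cont by auto

lemma C1_x_dx_dt_q: "C1_x J X (dx X (dt J q))"
  and dx_dx_dt_q: "t \<in> J \<Longrightarrow> x \<in> closure X \<Longrightarrow> dx X (dx X (dt J q)) t x = 0"
  using C1_x_quadratic[OF nb, of J "dx X (dt J q)" d' "\<lambda>_. 0" "\<lambda>_. 0"] dx_dt_q cont by auto

lemma regular: "regular_wave J X z q"
proof -
  have "(\<lambda>t. z t x) differentiable_on J" if x: "x \<in> closure X" for x
    unfolding differentiable_on_def real_differentiable_def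
  proof
    fix t assume t: "t \<in> J"
    have "((\<lambda>t. z t x) has_real_derivative Z' t) (at t within J)"
      by (rule has_real_derivative_within_cong[OF Z'[OF t] t]) (simp add: z x)
    then show "\<exists>D. ((\<lambda>t. z t x) has_real_derivative D) (at t within J)" ..
  qed
  moreover have "(\<lambda>t. q t x) differentiable_on J" if x: "x \<in> closure X" for x
    unfolding differentiable_on_def real_differentiable_def
  proof
    fix t assume t: "t \<in> J"
    have "((\<lambda>t. c t + d t * x) has_real_derivative c' t + d' t * x) (at t within J)"
      by (auto intro!: derivative_eq_intros c' d' t)
    then have "((\<lambda>t. q t x) has_real_derivative c' t + d' t * x) (at t within J)"
      by (rule has_real_derivative_within_cong[OF _ t]) (simp add: q x)
    then show "\<exists>D. ((\<lambda>t. q t x) has_real_derivative D) (at t within J)" ..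
  qed
  moreover have "cont_tx J X (dt J z)"
    by (rule cont_tx_cong[OF cont_tx_quadratic[where a=Z' and b="\<lambda>_. 0" and e="\<lambda>_. 0"]])
      (simp_all add: dt_z cont)
  moreover have "cont_tx J X (dt J q)"
    using C1_x_dt_q by (simp add: C1_x_def)
  ultimately show ?thesis
    using C1_x_z C1_x_q C1_x_dt_q C1_x_dx_dt_q by (simp add: regular_wave_def C1_tx_def)
qed

text \<open>A spatially constant elevation removes the hydrostatic term and an affine discharge the
  dispersive one; acceleration and convection remain.\<close>

lemma momentum:
  assumes t: "t \<in> J" and x: "x \<in> closure X" and h: "0 < hgt p z t x"
  shows "momentum_lhs p J X z q t x
    = c' t + d' t * x + eps p * (2 * (c t + d t * x) * d t / hgt p z t x)"
proof -
  have hx: "hgt p z t y = 1 + eps p * Z t" if "y \<in> closure X" for y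
    using z[OF t that] by (simp add: hgt_def)
  have "((\<lambda>y. (c t + d t * y)\<^sup>2 / (1 + eps p * Z t)) has_real_derivative
      2 * (c t + d t * x) * d t / (1 + eps p * Z t)) (at x within closure X)"
    using h hx[OF x] by (auto intro!: derivative_eq_intros)
  then have "dx X (\<lambda>s y. (q s y)\<^sup>2 / hgt p z s y) t x
      = 2 * (c t + d t * x) * d t / (1 + eps p * Z t)"
    by (rule dx_eq_cong[rotated]) (use x nb q[OF t] hx in auto)
  then show ?thesis
    by (simp add: momentum_lhs_def dt_q[OF t x] dx_dx_dt_q[OF t x] dx_z[OF t x] hx[OF x])
qed

end

lemma at_within_dom_neq_bot:
  assumes "admissible p"
  shows "x \<in> closure (dom_int p) \<Longrightarrow> at x within closure (dom_int p) \<noteq> bot"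
    and "x \<in> closure (dom_plus p) \<Longrightarrow> at x within closure (dom_plus p) \<noteq> bot"
proof -
  have r: "0 < rad p" "rad p < ell p"
    using assms by (auto simp: admissible_def)
  show "at x within closure (dom_int p) \<noteq> bot" if "x \<in> closure (dom_int p)"
    using r that at_within_interval_neq_bot[of "{- rad p..rad p}" x "if x = rad p then - rad p else rad p"]
    by (auto simp: dom_int_def is_interval_cc split: if_splits)
  show "at x within closure (dom_plus p) \<noteq> bot" if "x \<in> closure (dom_plus p)"
    using r that at_within_interval_neq_bot[of "{rad p..ell p}" x "if x = rad p then ell p else rad p"]
    by (auto simp: dom_plus_def is_interval_cc split: if_splits)
qed

subsection \<open>Elimination of the pressure\<close>

text \<open>Integrating once from \<open>a\<close> gives the pressure relative to its trace there.
  In the second integral the cubic terms combine as \<open>(1 - 1/3) / 2 = 1/3\<close>.\<close>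

lemma integral_quadratic_pressure:
  fixes P :: "real \<Rightarrow> real"
  assumes ab: "a < b" and cont: "continuous_on {a..b} P"
    and der: "\<And>x. a < x \<Longrightarrow> x < b \<Longrightarrow> (P has_real_derivative - k * (b - x)) (at x)"
  shows "integral {a<..<b} P = (b - a) * P a - k * (b - a) ^ 3 / 3"
proof -
  have P: "P x = P a - k * ((b - a)\<^sup>2 - (b - x)\<^sup>2) / 2" if "a \<le> x" "x \<le> b" for x
  proof -
    have "P x + k * ((b - a)\<^sup>2 - (b - x)\<^sup>2) / 2 = P a + k * ((b - a)\<^sup>2 - (b - a)\<^sup>2) / 2"
    proof (rule DERIV_isconst2[OF ab _ _ that])
      show "continuous_on {a..b} (\<lambda>x. P x + k * ((b - a)\<^sup>2 - (b - x)\<^sup>2) / 2)"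
        by (intro continuous_intros cont) simp
      show "((\<lambda>x. P x + k * ((b - a)\<^sup>2 - (b - x)\<^sup>2) / 2) has_real_derivative 0) (at x)"
        if "a < x" "x < b" for x
        by (auto intro!: derivative_eq_intros der that)
    qed
    then show ?thesis by simp
  qed
  let ?A = "\<lambda>x. P a * x - k * ((b - a)\<^sup>2 * x + (b - x) ^ 3 / 3) / 2"
  have "((\<lambda>x. P a - k * ((b - a)\<^sup>2 - (b - x)\<^sup>2) / 2) has_integral ?A b - ?A a) {a..b}"
  proof (rule fundamental_theorem_of_calculus)
    show "(?A has_vector_derivative P a - k * ((b - a)\<^sup>2 - (b - x)\<^sup>2) / 2) (at x within {a..b})" for x
      unfolding has_real_derivative_iff_has_vector_derivative[symmetric]
      by (auto intro!: derivative_eq_intros)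
  qed (use ab in simp)
  then have "(P has_integral ?A b - ?A a) {a..b}"
    by (rule has_integral_eq[rotated]) (rule P[symmetric], auto)
  then have "integral {a<..<b} P = ?A b - ?A a"
    by (simp add: has_integral_Icc_iff_Ioo integral_unique)
  also have "\<dots> = (b - a) * P a - k * (b - a) ^ 3 / 3"
    by (simp add: field_simps power2_eq_square power3_eq_cube)
  finally show ?thesis .
qed

text \<open>Eliminates the pressure trace \<open>\<P>(r)\<close> (here \<open>Pr\<close>) between Newton's law and the coupling
  condition.\<close>

lemma newton_iff_spring_mass:
  fixes e :: real
  assumes e: "0 < e" "0 < L" and hc: "0 < hc"
    and jump: "- e * \<alpha> * L * y' / e = (et + Pr / e + (e * (y * L)\<^sup>2 / (2 * hc\<^sup>2) + m\<^sup>2 * y' / hc))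
      - (Z + (e * (y * L)\<^sup>2 / (2 * hb\<^sup>2) - m\<^sup>2 * w / hb))"
  shows "T * y' = - zb - P * (zb - \<kappa> * M) + et
      + 1 / (e * L) * (L * Pr - e / hc * (y' - 2 * e * y\<^sup>2 / hc) * L ^ 3 / 3)
    \<longleftrightarrow> (T + \<alpha> * L + L\<^sup>2 / (3 * hc) + m\<^sup>2 / hc) * y' = - (1 + P) * zb + \<kappa> * P * M
      + e * (L\<^sup>2 / 2 * (1 / hb\<^sup>2 + 1 / (3 * hc\<^sup>2))) * y\<^sup>2 + Z - m\<^sup>2 * w / hb"
proof -
  have mean: "1 / (e * L) * (L * Pr - e / hc * (y' - 2 * e * y\<^sup>2 / hc) * L ^ 3 / 3)
      = Pr / e - L\<^sup>2 / (3 * hc) * y' + 2 / 3 * (e * L\<^sup>2 * y\<^sup>2 / hc\<^sup>2)"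
    using e hc by (simp add: field_simps power2_eq_square power3_eq_cube)
  have Pr: "Pr / e = - (\<alpha> * L * y') - et - e * L\<^sup>2 * y\<^sup>2 / hc\<^sup>2 / 2 - m\<^sup>2 / hc * y' + Z
      + e * L\<^sup>2 * y\<^sup>2 / hb\<^sup>2 / 2 - m\<^sup>2 * w / hb"
    using jump e by (simp add: power_mult_distrib mult.commute mult.left_commute)
  have \<beta>: "e * (L\<^sup>2 / 2 * (1 / hb\<^sup>2 + 1 / (3 * hc\<^sup>2))) * y\<^sup>2
      = e * L\<^sup>2 * y\<^sup>2 / hb\<^sup>2 / 2 + e * L\<^sup>2 * y\<^sup>2 / hc\<^sup>2 / 6"
    by (simp add: ring_distribs)
  have split: "(T + \<alpha> * L + L\<^sup>2 / (3 * hc) + m\<^sup>2 / hc) * y'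
      = T * y' + \<alpha> * L * y' + L\<^sup>2 / (3 * hc) * y' + m\<^sup>2 / hc * y'"
    "P * (zb - \<kappa> * M) = P * zb - \<kappa> * P * M" "- (1 + P) * zb = - zb - P * zb"
    by (simp_all add: algebra_simps)
  \<comment> \<open>With the products abstracted to atoms, the equivalence is linear. The elevation
    \<open>et\<close> cancels, and \<open>2/3 - 1/2 = 1/6\<close> yields the \<open>hc\<close> term
    of \<open>beta\<close>.\<close>
  have linear: "A = - zb - (B - C) + et + (- D - et - X / 2 - E + Z + H / 2 - W - F + 2 / 3 * X)
    \<longleftrightarrow> A + D + F + E = - zb - B + C + (H / 2 + X / 6) + Z - W" for A B C D E F H W X :: real
    by auto
  show ?thesis
    unfolding mean Pr \<beta> split by (rule linear)
qed

lemma C1_x_has_derivative_interior: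
  assumes "C1_x J X f" "t \<in> J" "x \<in> X" "open X"
  shows "(f t has_real_derivative dx X f t x) (at x)"
proof -
  have "x \<in> closure X"
    using assms(3) closure_subset by blast
  then have "(f t has_real_derivative dx X f t x) (at x within closure X)"
    by (rule C1_x_has_derivative[OF assms(1,2)])
  then have "(f t has_real_derivative dx X f t x) (at x within X)"
    by (rule has_field_derivative_subset) (rule closure_subset)
  then show ?thesis
    by (simp add: at_within_open[OF assms(3,4)])
qed

lemma closure_dom:
  assumes "admissible p"
  shows "closure (dom_minus p) = {..- rad p}" "closure (dom_int p) = {- rad p..rad p}"
    "closure (dom_plus p) = {rad p..ell p}"
  using assms by (auto simp: admissible_def dom_minus_def dom_int_def dom_plus_def)

lemma interior_affine_flow:
  assumes "admissible p" "time_interval J" "C2_time J zb"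
    and "\<And>t x. t \<in> J \<Longrightarrow> x \<in> closure (dom_int p) \<Longrightarrow> z t x = zeta_w p"
    and "\<And>t x. t \<in> J \<Longrightarrow> x \<in> closure (dom_int p) \<Longrightarrow> q t x = ddt J zb t * len_plus p"
  shows "affine_flow J (dom_int p) z q (\<lambda>_. zeta_w p) (\<lambda>_. 0) (\<lambda>t. ddt J zb t * len_plus p)
    (\<lambda>t. ddt J (ddt J zb) t * len_plus p) (\<lambda>_. 0) (\<lambda>_. 0)"
proof
  show "continuous_on J (\<lambda>t. ddt J (ddt J zb) t * len_plus p)"
    using assms(3) by (intro continuous_intros) (simp add: C2_time_def)
qed (use assms at_within_dom_neq_bot(1)
    in \<open>auto intro!: derivative_eq_intros C2_time_has_derivative\<close>)

lemma chamber_affine_flow: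
  assumes "admissible p" "time_interval J" "C2_time J zb"
    and "\<And>t x. t \<in> J \<Longrightarrow> x \<in> closure (dom_plus p) \<Longrightarrow> z t x = eta_eq p + zb t"
    and "\<And>t x. t \<in> J \<Longrightarrow> x \<in> closure (dom_plus p) \<Longrightarrow> q t x = ddt J zb t * (ell p - x)"
  shows "affine_flow J (dom_plus p) z q (\<lambda>t. eta_eq p + zb t) (ddt J zb)
    (\<lambda>t. ddt J zb t * ell p) (\<lambda>t. ddt J (ddt J zb) t * ell p)
    (\<lambda>t. - ddt J zb t) (\<lambda>t. - ddt J (ddt J zb) t)"
proof
  have c: "continuous_on J (ddt J (ddt J zb))" "continuous_on J (ddt J zb)"
    using assms(3) by (auto simp: C2_time_def intro: differentiable_imp_continuous_on)
  show "continuous_on J (\<lambda>t. ddt J (ddt J zb) t * ell p)"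
    "continuous_on J (\<lambda>t. - ddt J (ddt J zb) t)" "continuous_on J (ddt J zb)"
    by (intro continuous_intros c)+
qed (use assms at_within_dom_neq_bot(2)
    in \<open>auto intro!: derivative_eq_intros C2_time_has_derivative simp: algebra_simps\<close>)

text \<open>Serves both implications: the hypotheses hold for a given solution of the column system
  and for the reconstructed unknowns alike. The pressures enter only through their regularity, the
  momentum equations, the coupling condition and the vanishing trace of \<open>Pm\<close>.\<close>

lemma newton_law_iff:
  fixes s :: unknowns
  defines "zb \<equiv> zbar s"
  assumes adm: "admissible p" and J: "time_interval J" and C2: "C2_time J zb"
    and zi: "\<And>t x. t \<in> J \<Longrightarrow> x \<in> closure (dom_int p) \<Longrightarrow> zi s t x = zeta_w p"
    and qi: "\<And>t x. t \<in> J \<Longrightarrow> x \<in> closure (dom_int p) \<Longrightarrow> qi s t x = ddt J zb t * len_plus p"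
    and eta: "\<And>t x. t \<in> J \<Longrightarrow> x \<in> closure (dom_plus p) \<Longrightarrow> eta s t x = eta_eq p + zb t"
    and qc: "\<And>t x. t \<in> J \<Longrightarrow> x \<in> closure (dom_plus p) \<Longrightarrow> qc s t x = ddt J zb t * (ell p - x)"
    and qm: "\<And>t. t \<in> J \<Longrightarrow> qm s t (- rad p) = ddt J zb t * len_plus p"
    and hc: "\<And>t. t \<in> J \<Longrightarrow> 0 < h_wc p (zb t)"
    and Pm: "\<And>t. t \<in> J \<Longrightarrow> Pm s t (- rad p) = 0"
    and C1: "C1_x J (dom_int p) (Pint s)" "C1_x J (dom_plus p) (Pc s)"
    and mom: "momentum_eq p J (dom_int p) (zi s) (qi s) (Pint s)"
      "momentum_eq p J (dom_plus p) (eta s) (qc s) (Pc s)"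
    and ii: "property_ii p J s"
  shows "newton_law p J s \<longleftrightarrow> spring_mass_trace_ode p J (zm s) (qm s) zb"
proof -
  let ?r = "rad p" and ?l = "ell p" and ?e = "eps p" and ?L = "len_plus p"
  have p: "0 < ?e" "0 < ?r" "?r < ?l" "0 < h_w p"
    using adm by (auto simp: admissible_def)
  have L: "0 < ?L" "?l - ?r = ?L" using p by (auto simp: len_plus_def)
  note cl = closure_dom[OF adm]
  interpret I: affine_flow J "dom_int p" "zi s" "qi s" "\<lambda>_. zeta_w p" "\<lambda>_. 0"
    "\<lambda>t. ddt J zb t * ?L" "\<lambda>t. ddt J (ddt J zb) t * ?L" "\<lambda>_. 0" "\<lambda>_. 0"
    by (rule interior_affine_flow[OF adm J C2 zi qi])
  interpret C: affine_flow J "dom_plus p" "eta s" "qc s" "\<lambda>t. eta_eq p + zb t" "ddt J zb"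
    "\<lambda>t. ddt J zb t * ?l" "\<lambda>t. ddt J (ddt J zb) t * ?l" "\<lambda>t. - ddt J zb t"
    "\<lambda>t. - ddt J (ddt J zb) t"
    by (rule chamber_affine_flow[OF adm J C2 eta qc])
  have "(\<forall>x\<in>dom_plus p. T_buo_sq p * ddt J (ddt J zb) t =
       - zb t - P0 p * (zb t - kappa p * memory p zb t) + eta s t x
       + 1 / (?e * ?L) * integral (dom_plus p) (Pc s t)) \<longleftrightarrow>
     (let hb = hgt p (zm s) t (- ?r); hc = h_wc p (zb t) in
     (calT_sq p hc + (mut p)\<^sup>2 / hc) * ddt J (ddt J zb) t =
       - (1 + P0 p) * zb t + kappa p * P0 p * memory p zb t
       + ?e * beta p hb hc * (ddt J zb t)\<^sup>2 + zm s t (- ?r)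
       - (mut p)\<^sup>2 * dx (dom_minus p) (dt J (qm s)) t (- ?r) / hb)" if t: "t \<in> J" for t
  proof -
    define y where "y = ddt J zb t"
    define y' where "y' = ddt J (ddt J zb) t"
    define hc where "hc = h_wc p (zb t)"
    define hb where "hb = hgt p (zm s) t (- ?r)"
    define w where "w = dx (dom_minus p) (dt J (qm s)) t (- ?r)"
    have hc0: "0 < hc" using hc[OF t] by (simp add: hc_def)
    have hgt_int: "hgt p (zi s) t x = h_w p" if "x \<in> closure (dom_int p)" for x
      using zi[OF t that] by (simp add: hgt_def h_w_def)
    have hgt_plus: "hgt p (eta s) t x = hc" if "x \<in> closure (dom_plus p)" for x
      using eta[OF t that] by (simp add: hgt_def hc_def h_wc_def algebra_simps)
    have dPint: "dx (dom_int p) (Pint s) t x = - (?e * y' * ?L / h_w p)" if x: "x \<in> dom_int p" for x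
    proof -
      have x': "x \<in> closure (dom_int p)" using x closure_subset by blast
      have "y' * ?L = - (h_w p / ?e) * dx (dom_int p) (Pint s) t x"
        using mom(1) t x I.momentum[OF t x', of p] hgt_int[OF x'] p
        by (simp add: momentum_eq_def y'_def)
      then show ?thesis using p by (simp add: field_simps)
    qed
    \<comment> \<open>The interior pressure has a slope independent of \<open>x\<close>. Its jump
      over the length \<open>2 r\<close> is the source of the added mass
      \<open>alpha\<close>.\<close>
    have "Pint s t ?r + ?e * y' * ?L / h_w p * ?r = Pint s t (- ?r) + ?e * y' * ?L / h_w p * (- ?r)"
    proof (rule DERIV_isconst2[where a="- ?r" and b="?r"])
      show "continuous_on {- ?r..?r} (\<lambda>x. Pint s t x + ?e * y' * ?L / h_w p * x)"
        using C1_x_cont(1)[OF C1(1) t] by (intro continuous_intros) (simp add: cl)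
      fix x assume "- ?r < x" "x < ?r"
      then have x: "x \<in> dom_int p" by (simp add: dom_int_def)
      have "(Pint s t has_real_derivative - (?e * y' * ?L / h_w p)) (at x)"
        using C1_x_has_derivative_interior[OF C1(1) t x] dPint[OF x] by (simp add: dom_int_def)
      then show "((\<lambda>x. Pint s t x + ?e * y' * ?L / h_w p * x) has_real_derivative 0) (at x)"
        using p by (auto intro!: derivative_eq_intros)
    qed (use p in auto)
    then have "Pint s t ?r - Pint s t (- ?r) = - ?e * alpha p * ?L * y'"
      by (simp add: alpha_def algebra_simps)
    then have Pint: "(Pint s t ?r - Pint s t (- ?r)) / ?e = - ?e * alpha p * ?L * y' / ?e"
      by simp
    \<comment> \<open>Acceleration and convection in the chamber are both proportional to the
      distance to the wall, so the pressure gradient is as well.\<close>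
    have dPc: "(Pc s t has_real_derivative - (?e / hc * (y' - 2 * ?e * y\<^sup>2 / hc)) * (?l - x)) (at x)"
      if "?r < x" "x < ?l" for x
    proof -
      have x: "x \<in> dom_plus p" using that by (simp add: dom_plus_def)
      have x': "x \<in> closure (dom_plus p)" using x closure_subset by blast
      have "y' * ?l - y' * x + ?e * (2 * (y * ?l - y * x) * (- y) / hc)
          = - (hc / ?e) * dx (dom_plus p) (Pc s) t x"
        using mom(2) t x C.momentum[OF t x', of p] hgt_plus[OF x'] hc0
        by (simp add: momentum_eq_def y'_def y_def)
      then have "dx (dom_plus p) (Pc s) t x
          = - (?e / hc) * (y' * ?l - y' * x + ?e * (2 * (y * ?l - y * x) * (- y) / hc))"
        using p hc0 by simp
      also have "\<dots> = - (?e / hc * (y' - 2 * ?e * y\<^sup>2 / hc)) * (?l - x)"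
        using hc0 by (simp add: field_simps power2_eq_square)
      finally show ?thesis
        using C1_x_has_derivative_interior[OF C1(2) t x] by (simp add: dom_plus_def)
    qed
    have int: "integral (dom_plus p) (Pc s t)
        = ?L * Pc s t ?r - ?e / hc * (y' - 2 * ?e * y\<^sup>2 / hc) * ?L ^ 3 / 3"
      unfolding dom_plus_def L(2)[symmetric]
      by (rule integral_quadratic_pressure) (use p C1_x_cont(1)[OF C1(2) t] dPc cl in auto)
    have r: "?r \<in> closure (dom_plus p)" using p by (simp add: cl)
    have "(Pint s t ?r - Pint s t (- ?r)) / ?e
        = (eta s t ?r + Pc s t ?r / ?e + frakE p J (dom_plus p) (eta s) (qc s) t ?r)
        - (zm s t (- ?r) + Pm s t (- ?r) / ?e + frakE p J (dom_minus p) (zm s) (qm s) t (- ?r))"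
      using ii t by (simp add: property_ii_def)
    \<comment> \<open>Here \<open>dx (dt q) = - y'\<close>, so the dispersive energy term enters
      with a plus sign and supplies \<open>(mut p)^2 / hc\<close> in the inertia
      coefficient.\<close>
    moreover have "frakE p J (dom_plus p) (eta s) (qc s) t ?r
        = ?e * (y * ?L)\<^sup>2 / (2 * hc\<^sup>2) + (mut p)\<^sup>2 * y' / hc"
      by (simp add: frakE_def C.dx_dt_q[OF t r] hgt_plus[OF r] qc[OF t r] y_def y'_def L(2))
    moreover have "frakE p J (dom_minus p) (zm s) (qm s) t (- ?r)
        = ?e * (y * ?L)\<^sup>2 / (2 * hb\<^sup>2) - (mut p)\<^sup>2 * w / hb"
      by (simp add: frakE_def qm[OF t] y_def hb_def w_def)
    ultimately have jump: "- ?e * alpha p * ?L * y' / ?e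
        = (eta_eq p + zb t + Pc s t ?r / ?e + (?e * (y * ?L)\<^sup>2 / (2 * hc\<^sup>2) + (mut p)\<^sup>2 * y' / hc))
        - (zm s t (- ?r) + (?e * (y * ?L)\<^sup>2 / (2 * hb\<^sup>2) - (mut p)\<^sup>2 * w / hb))"
      unfolding Pint eta[OF t r] by (simp add: Pm[OF t])
    have "(?r + ?l) / 2 \<in> dom_plus p" using p by (simp add: dom_plus_def)
    then have ex: "(\<forall>x\<in>dom_plus p. Q) \<longleftrightarrow> Q" for Q by blast
    have eta': "eta s t x = eta_eq p + zb t" if "x \<in> dom_plus p" for x
      using eta[OF t] that closure_subset by blast
    have "(\<forall>x\<in>dom_plus p. T_buo_sq p * y' =
         - zb t - P0 p * (zb t - kappa p * memory p zb t) + eta s t x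
         + 1 / (?e * ?L) * integral (dom_plus p) (Pc s t)) \<longleftrightarrow>
      (\<forall>x\<in>dom_plus p. T_buo_sq p * y' =
         - zb t - P0 p * (zb t - kappa p * memory p zb t) + (eta_eq p + zb t)
         + 1 / (?e * ?L) * integral (dom_plus p) (Pc s t))"
      by (rule ball_cong) (simp_all add: eta')
    then show ?thesis
      unfolding Let_def y_def[symmetric] y'_def[symmetric] hc_def[symmetric] hb_def[symmetric]
        w_def[symmetric] calT_sq_def beta_def ex int newton_iff_spring_mass[OF p(1) L(1) hc0 jump] .
  qed
  then show ?thesis
    unfolding newton_law_def spring_mass_trace_ode_def zb_def[symmetric] by (rule ball_cong[OF refl])
qed

section \<open>The two implications of the equivalence\<close>

lemma constant_on_closure:
  assumes "C1_x J X f" "t \<in> J" "\<And>x. x \<in> X \<Longrightarrow> f t x = a" "x \<in> closure X"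
  shows "f t x = a"
  using continuous_constant_on_closure[OF C1_x_cont(1)[OF assms(1,2)] assms(3,4)] .

lemma affine_on_closure:
  assumes C1: "C1_x J {a<..<b} f" and t: "t \<in> J" and "a < b"
    and dx: "\<And>x. a < x \<Longrightarrow> x < b \<Longrightarrow> dx {a<..<b} f t x = k" and x: "a \<le> x" "x \<le> b"
  shows "f t x = f t a + k * (x - a)"
proof -
  have "f t x - k * x = f t a - k * a"
  proof (rule DERIV_isconst2[OF \<open>a < b\<close> _ _ x])
    show "continuous_on {a..b} (\<lambda>x. f t x - k * x)"
      using C1_x_cont(1)[OF C1 t] \<open>a < b\<close> by (intro continuous_intros) simp
    show "((\<lambda>x. f t x - k * x) has_real_derivative 0) (at x)" if "a < x" "x < b" for x
      using C1_x_has_derivative_interior[OF C1 t, of x] dx[OF that] that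
      by (auto intro!: derivative_eq_intros)
  qed
  then show ?thesis by (simp add: algebra_simps)
qed

text \<open>The mass equations prescribe the slope of the discharge, namely
  \<open>- ddt J (zbar s) t\<close> in the chamber and 0 in the interior. The wall condition fixes
  the chamber discharge, and continuity at \<open>x = r\<close> passes its value on to the
  interior.\<close>

lemma fluid_column_system_structure:
  assumes adm: "admissible p" and J: "time_interval J"
    and sys: "fluid_column_system p J s" and i: "property_i p J s" and t: "t \<in> J"
  shows "x \<in> closure (dom_int p) \<Longrightarrow> zi s t x = zeta_w p"
    and "x \<in> closure (dom_int p) \<Longrightarrow> qi s t x = ddt J (zbar s) t * len_plus p"
    and "x \<in> closure (dom_plus p) \<Longrightarrow> eta s t x = eta_eq p + zbar s t"
    and "x \<in> closure (dom_plus p) \<Longrightarrow> qc s t x = ddt J (zbar s) t * (ell p - x)"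
proof -
  let ?r = "rad p" and ?l = "ell p" and ?y = "ddt J (zbar s) t"
  have p: "0 < ?r" "?r < ?l"
    using adm by (auto simp: admissible_def)
  note cl = closure_dom[OF adm]
  have C2: "C2_time J (zbar s)"
    and C1: "C1_x J (dom_int p) (zi s)" "C1_x J (dom_int p) (qi s)"
      "C1_x J (dom_plus p) (eta s)" "C1_x J (dom_plus p) (qc s)"
    using sys by (auto simp: fluid_column_system_def regular_unknowns_def regular_wave_def C1_tx_def)
  have zi: "zi s t x = zeta_w p" if "x \<in> dom_int p" "t \<in> J" for x t
    using sys that by (simp add: fluid_column_system_def)
  have eta: "eta s t x = eta_eq p + zbar s t" if "x \<in> dom_plus p" "t \<in> J" for x t
    using sys that by (simp add: fluid_column_system_def)
  show "zi s t x = zeta_w p" if "x \<in> closure (dom_int p)"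
    by (rule constant_on_closure[OF C1(1) t zi[OF _ t] that])
  show "eta s t x = eta_eq p + zbar s t" if "x \<in> closure (dom_plus p)"
    by (rule constant_on_closure[OF C1(3) t eta[OF _ t] that])
  have dxq: "dx (dom_int p) (qi s) t x = 0" if x: "x \<in> dom_int p" for x
  proof -
    have "dt J (zi s) t x = 0"
      by (rule dt_eq[where g="\<lambda>_. zeta_w p", OF _ _ J t]) (simp_all add: zi[OF x])
    moreover have "dt J (zi s) t x + dx (dom_int p) (qi s) t x = 0"
      using sys t x by (simp add: fluid_column_system_def mass_eq_def)
    ultimately show ?thesis by simp
  qed
  have qi: "qi s t x = qi s t (- ?r)" if "x \<in> closure (dom_int p)" for x
    using affine_on_closure[of J "- ?r" ?r "qi s" t 0 x] C1(2) t p dxq that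
    by (simp add: cl dom_int_def)
  have dxc: "dx (dom_plus p) (qc s) t x = - ?y" if x: "x \<in> dom_plus p" for x
  proof -
    have "((\<lambda>u. eta_eq p + zbar s u) has_real_derivative ?y) (at t within J)"
      using C2_time_has_derivative(1)[OF C2 t] by (auto intro!: derivative_eq_intros)
    then have "dt J (eta s) t x = ?y"
      by (rule dt_eq[OF _ _ J t, rotated]) (rule eta[OF x])
    moreover have "dt J (eta s) t x + dx (dom_plus p) (qc s) t x = 0"
      using sys t x by (simp add: fluid_column_system_def mass_eq_def)
    ultimately show ?thesis by simp
  qed
  have qc: "qc s t x = qc s t ?r - ?y * (x - ?r)" if "x \<in> closure (dom_plus p)" for x
    using affine_on_closure[of J ?r ?l "qc s" t "- ?y" x] C1(4) t p dxc that
    by (simp add: cl dom_plus_def)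
  have "qc s t ?l = 0"
    using sys t by (simp add: fluid_column_system_def)
  then have qcr: "qc s t ?r = ?y * len_plus p"
    using qc[of ?l] p by (simp add: cl len_plus_def)
  show "qc s t x = ?y * (?l - x)" if "x \<in> closure (dom_plus p)"
    using qc[OF that] qcr by (simp add: len_plus_def algebra_simps)
  show "qi s t x = ?y * len_plus p" if "x \<in> closure (dom_int p)"
    using qi[OF that] qi[of ?r] i t qcr p by (simp add: property_i_def cl)
qed

lemma fluid_column_imp_wave_spring_mass:
  assumes adm: "admissible p" and J: "time_interval J"
    and sys: "fluid_column_system p J s" and i: "property_i p J s" and ii: "property_ii p J s"
  shows "wave_spring_mass_system p J (zm s) (qm s) (zbar s)"
proof -
  let ?r = "rad p" and ?X = "dom_minus p"
  have p: "0 < ?r" "?r < ell p" "0 < eps p" "eps p \<le> 1" "0 \<le> mut p"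
    using adm by (auto simp: admissible_def)
  note cl = closure_dom[OF adm]
  note struct = fluid_column_system_structure[OF adm J sys i]
  have reg: "regular_wave J ?X (zm s) (qm s)" "decaying J ?X (zm s) (qm s)" "C2_time J (zbar s)"
      "C1_x J ?X (Pm s)" "C1_x J (dom_int p) (Pint s)" "C1_x J (dom_plus p) (Pc s)"
    and pos: "positive_height p J ?X (zm s)" "positive_height p J (dom_plus p) (eta s)"
    and mass: "mass_eq J ?X (zm s) (qm s)" and far: "far_field J (zm s) (qm s)"
    and mom: "momentum_eq p J ?X (zm s) (qm s) (Pm s)"
      "momentum_eq p J (dom_int p) (zi s) (qi s) (Pint s)"
      "momentum_eq p J (dom_plus p) (eta s) (qc s) (Pc s)"
    and newton: "newton_law p J s"
    using sys by (auto simp: fluid_column_system_def regular_unknowns_def)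
  \<comment> \<open>The extension to the closure gives both a vanishing gradient in the momentum
    equation and a vanishing trace at \<open>-r\<close> in the coupling condition.\<close>
  have Pm: "Pm s t x = 0" if "t \<in> J" "x \<in> closure ?X" for t x
    using sys that
    by (intro constant_on_closure[OF reg(4) that(1) _ that(2)]) (simp add: fluid_column_system_def)
  have hc: "0 < h_wc p (zbar s t)" if "t \<in> J" for t
  proof -
    have "?r \<in> closure (dom_plus p)" using p by (simp add: cl)
    then have "0 < hgt p (eta s) t ?r" "eta s t ?r = eta_eq p + zbar s t"
      using pos(2) that struct(3) by (auto simp: positive_height_def)
    then show ?thesis
      by (simp add: hgt_def h_wc_def distrib_left add.assoc)
  qed
  have momm: "momentum_lhs p J ?X (zm s) (qm s) t x = 0" if t: "t \<in> J" and x: "x \<in> ?X" for t x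
  proof -
    have x': "x \<in> closure ?X" using x closure_subset by blast
    have "dx ?X (Pm s) t x = 0"
      by (rule dx_eq_cong[where g="\<lambda>_. 0"])
        (use Pm t x' at_within_atMost_neq_bot in \<open>auto simp: cl\<close>)
    then show ?thesis
      using mom(1) t x by (simp add: momentum_eq_def)
  qed
  have qm: "qm s t (- ?r) = ddt J (zbar s) t * len_plus p" if "t \<in> J" for t
    using i that struct(2)[OF that, of "- ?r"] p by (simp add: property_i_def cl)
  have "newton_law p J s \<longleftrightarrow> spring_mass_trace_ode p J (zm s) (qm s) (zbar s)"
    by (rule newton_law_iff[OF adm J reg(3) struct qm hc Pm reg(5,6) mom(2,3) ii]) (simp_all add: cl)
  then have "spring_mass_trace_ode p J (zm s) (qm s) (zbar s)"
    using newton by simp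
  then have "(mut p = 0 \<longrightarrow> spring_mass_ode p J (zm s) (zbar s)) \<and>
      (mut p \<noteq> 0 \<longrightarrow> spring_mass_ode_mu p J (zm s) (qm s) (zbar s))"
    by (subst spring_mass_trace_ode_iff[OF p(3-5) J reg(1,2) pos(1) far _ reg(3)])
      (use momm qm in auto)
  then show ?thesis
    unfolding wave_spring_mass_system_def using reg pos mass far hc momm qm by simp
qed

text \<open>The interior and chamber flows are prescribed by the structure just derived, and the
  pressures by integrating the momentum equations in \<open>x\<close>. The free function of time in
  the chamber pressure is spent on the coupling condition.\<close>

lemma wave_spring_mass_imp_fluid_column:
  assumes adm: "admissible p" and J: "time_interval J"
    and sys: "wave_spring_mass_system p J z q zb"
  obtains s where "fluid_column_system p J s" "property_i p J s" "property_ii p J s"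
    "zm s = z" "qm s = q" "zbar s = zb"
proof -
  let ?r = "rad p" and ?l = "ell p" and ?e = "eps p" and ?L = "len_plus p" and ?X = "dom_minus p"
  have p: "0 < ?r" "?r < ?l" "0 < ?e" "?e \<le> 1" "0 \<le> mut p" "0 < h_w p"
    using adm by (auto simp: admissible_def)
  note cl = closure_dom[OF adm]
  have reg: "regular_wave J ?X z q" "decaying J ?X z q" and C2: "C2_time J zb"
    and pos: "positive_height p J ?X z" and hc0: "\<And>t. t \<in> J \<Longrightarrow> 0 < h_wc p (zb t)"
    and mass: "mass_eq J ?X z q" and far: "far_field J z q"
    and mom: "\<forall>t\<in>J. \<forall>x\<in>?X. momentum_lhs p J ?X z q t x = 0"
    and qr: "\<forall>t\<in>J. q t (- ?r) = ddt J zb t * ?L"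
    and odes: "(mut p = 0 \<longrightarrow> spring_mass_ode p J z zb) \<and>
      (mut p \<noteq> 0 \<longrightarrow> spring_mass_ode_mu p J z q zb)"
    using sys by (auto simp: wave_spring_mass_system_def)
  have ode: "spring_mass_trace_ode p J z q zb"
    using odes by (simp add: spring_mass_trace_ode_iff[OF p(3-5) J reg pos far mom C2 qr])
  define y where "y = ddt J zb"
  define y' where "y' = ddt J y"
  define hc where "hc = (\<lambda>t. h_wc p (zb t))"
  \<comment> \<open>The factor for which the chamber momentum equation reads
    \<open>dx Pc = - k (ell - x)\<close>.\<close>
  define k where "k = (\<lambda>t. ?e / hc t * (y' t - 2 * ?e * (y t)\<^sup>2 / hc t))"
  \<comment> \<open>The value of \<open>Pc / eps\<close> at \<open>x = r\<close>, obtained by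
    solving the coupling condition for it.\<close>
  define c where "c = (\<lambda>t. - (alpha p * ?L * y' t) - (eta_eq p + zb t)
    - (?e * (y t * ?L)\<^sup>2 / (2 * (hc t)\<^sup>2) + (mut p)\<^sup>2 * y' t / hc t)
    + z t (- ?r) + frakE p J ?X z q t (- ?r))"
  \<comment> \<open>Only the gradient and the jump of the interior pressure matter, so it is
    normalised to vanish at \<open>-r\<close>.\<close>
  define s where "s = \<lparr>zm = z, Pm = (\<lambda>_ _. 0), qm = q, zi = (\<lambda>_ _. zeta_w p),
    Pint = (\<lambda>t x. - (?e * y' t * ?L / h_w p) * (x + ?r)), qi = (\<lambda>t _. y t * ?L),
    eta = (\<lambda>t _. eta_eq p + zb t),
    Pc = (\<lambda>t x. ?e * c t - k t * ((?l - ?r)\<^sup>2 - (?l - x)\<^sup>2) / 2),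
    qc = (\<lambda>t x. y t * (?l - x)), zbar = zb\<rparr>"
  have sel: "zm s = z" "Pm s = (\<lambda>_ _. 0)" "qm s = q" "zi s = (\<lambda>_ _. zeta_w p)"
    "Pint s = (\<lambda>t x. - (?e * y' t * ?L / h_w p) * (x + ?r))" "qi s = (\<lambda>t _. y t * ?L)"
    "eta s = (\<lambda>t _. eta_eq p + zb t)"
    "Pc s = (\<lambda>t x. ?e * c t - k t * ((?l - ?r)\<^sup>2 - (?l - x)\<^sup>2) / 2)"
    "qc s = (\<lambda>t x. y t * (?l - x))" "zbar s = zb"
    by (simp_all add: s_def)
  interpret I: affine_flow J "dom_int p" "zi s" "qi s" "\<lambda>_. zeta_w p" "\<lambda>_. 0"
    "\<lambda>t. y t * ?L" "\<lambda>t. y' t * ?L" "\<lambda>_. 0" "\<lambda>_. 0"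
    unfolding y'_def y_def
    by (rule interior_affine_flow[OF adm J C2]) (simp_all add: sel y_def)
  interpret C: affine_flow J "dom_plus p" "eta s" "qc s" "\<lambda>t. eta_eq p + zb t" y
    "\<lambda>t. y t * ?l" "\<lambda>t. y' t * ?l" "\<lambda>t. - y t" "\<lambda>t. - y' t"
    unfolding y'_def y_def
    by (rule chamber_affine_flow[OF adm J C2]) (simp_all add: sel y_def)
  have cont_y: "continuous_on J zb" "continuous_on J y" "continuous_on J y'"
    using C2 by (auto simp: C2_time_def y_def y'_def intro: differentiable_imp_continuous_on)
  have hcp: "0 < hc t" if "t \<in> J" for t using hc0[OF that] by (simp add: hc_def)
  have hbp: "0 < hgt p z t (- ?r)" if "t \<in> J" for t
    using pos that by (simp add: positive_height_def cl)
  have cont_hc: "continuous_on J hc"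
    unfolding hc_def h_wc_def by (intro continuous_intros cont_y)
  have cont_k: "continuous_on J k"
    unfolding k_def using hcp
    by (intro continuous_intros cont_y cont_hc) (auto dest: less_imp_neq[symmetric])
  have tr: "- ?r \<in> closure ?X" by (simp add: cl)
  have cont_tr: "continuous_on J (\<lambda>t. z t (- ?r))" "continuous_on J (\<lambda>t. q t (- ?r))"
    "continuous_on J (\<lambda>t. dx ?X (dt J q) t (- ?r))"
    using reg(1) by (auto intro!: cont_tx_trace[OF _ tr]
        simp: regular_wave_def C1_tx_def C1_x_def)
  have cont_c: "continuous_on J c"
    unfolding c_def frakE_def hgt_def using hcp hbp
    by (intro continuous_intros cont_y cont_hc cont_tr)
      (auto simp: hgt_def dest: less_imp_neq[symmetric])
  have C1_Pm: "C1_x J ?X (Pm s)" and dx_Pm: "\<And>t x. t \<in> J \<Longrightarrow> x \<in> closure ?X \<Longrightarrow> dx ?X (Pm s) t x = 0"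
    using C1_x_quadratic[of ?X J "Pm s" "\<lambda>_. 0" "\<lambda>_. 0" "\<lambda>_. 0"] at_within_atMost_neq_bot
    by (auto simp: sel cl)
  have Pint_q: "Pint s t x = - (?e * y' t * ?L / h_w p) * ?r + - (?e * y' t * ?L / h_w p) * x + 0 * x\<^sup>2"
    for t x
    by (simp only: sel distrib_left)
  have cont_Pint: "continuous_on J (\<lambda>t. - (?e * y' t * ?L / h_w p))"
    "continuous_on J (\<lambda>t. - (?e * y' t * ?L / h_w p) * ?r)"
    using p by (auto intro!: continuous_intros cont_y)
  have C1_Pint: "C1_x J (dom_int p) (Pint s)"
    by (rule C1_x_quadratic(1)[OF _ Pint_q cont_Pint(2,1) continuous_on_const])
      (rule at_within_dom_neq_bot(1)[OF adm])
  have dx_Pint: "dx (dom_int p) (Pint s) t x = - (?e * y' t * ?L / h_w p) + 2 * 0 * x"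
    if "t \<in> J" "x \<in> closure (dom_int p)" for t x
    by (rule C1_x_quadratic(2)[OF _ Pint_q cont_Pint(2,1) continuous_on_const that])
      (rule at_within_dom_neq_bot(1)[OF adm])
  have Pc_q: "Pc s t x = (?e * c t - k t * (?l - ?r)\<^sup>2 / 2 + k t * ?l\<^sup>2 / 2) + - (k t * ?l) * x + k t / 2 * x\<^sup>2"
    for t x
    by (simp add: sel power2_diff field_simps)
  have cont_Pc: "continuous_on J (\<lambda>t. ?e * c t - k t * (?l - ?r)\<^sup>2 / 2 + k t * ?l\<^sup>2 / 2)"
    "continuous_on J (\<lambda>t. - (k t * ?l))" "continuous_on J (\<lambda>t. k t / 2)"
    by (auto intro!: continuous_intros cont_c cont_k)
  have C1_Pc: "C1_x J (dom_plus p) (Pc s)"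
    by (rule C1_x_quadratic(1)[OF _ Pc_q cont_Pc]) (rule at_within_dom_neq_bot(2)[OF adm])
  have dx_Pc: "dx (dom_plus p) (Pc s) t x = - (k t * ?l) + 2 * (k t / 2) * x"
    if "t \<in> J" "x \<in> closure (dom_plus p)" for t x
    by (rule C1_x_quadratic(2)[OF _ Pc_q cont_Pc that]) (rule at_within_dom_neq_bot(2)[OF adm])
  have hgt_int: "hgt p (zi s) t x = h_w p" for t x by (simp add: sel hgt_def h_w_def)
  have hgt_plus: "hgt p (eta s) t x = hc t" for t x
    by (simp add: sel hgt_def hc_def h_wc_def algebra_simps)
  have mom_m: "momentum_eq p J ?X (zm s) (qm s) (Pm s)"
    using mom dx_Pm closure_subset[of ?X] by (auto simp: momentum_eq_def sel(1,3))
  have mom_int: "momentum_eq p J (dom_int p) (zi s) (qi s) (Pint s)"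
    unfolding momentum_eq_def
  proof (intro ballI)
    fix t x assume t: "t \<in> J" and x: "x \<in> dom_int p"
    have x': "x \<in> closure (dom_int p)" using x closure_subset by blast
    show "momentum_lhs p J (dom_int p) (zi s) (qi s) t x
        = - (hgt p (zi s) t x / ?e) * dx (dom_int p) (Pint s) t x"
      using I.momentum[OF t x', of p] dx_Pint[OF t x'] p by (simp add: hgt_int)
  qed
  have mom_plus: "momentum_eq p J (dom_plus p) (eta s) (qc s) (Pc s)"
    unfolding momentum_eq_def
  proof (intro ballI)
    fix t x assume t: "t \<in> J" and x: "x \<in> dom_plus p"
    have x': "x \<in> closure (dom_plus p)" using x closure_subset by blast
    have "momentum_lhs p J (dom_plus p) (eta s) (qc s) t x
        = y' t * ?l - y' t * x + ?e * (2 * (y t * ?l - y t * x) * (- y t) / hc t)"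
      using C.momentum[OF t x', of p] hcp[OF t] by (simp add: hgt_plus)
    also have "\<dots> = - (hc t / ?e) * (- (k t * ?l) + 2 * (k t / 2) * x)"
      using p hcp[OF t] by (simp add: k_def field_simps power2_eq_square)
    finally show "momentum_lhs p J (dom_plus p) (eta s) (qc s) t x
        = - (hgt p (eta s) t x / ?e) * dx (dom_plus p) (Pc s) t x"
      by (simp only: hgt_plus dx_Pc[OF t x'])
  qed
  have i: "property_i p J s"
    using qr by (simp add: property_i_def sel y_def len_plus_def)
  have ii: "property_ii p J s"
    unfolding property_ii_def
  proof
    fix t assume t: "t \<in> J"
    have r: "?r \<in> closure (dom_plus p)" using p by (simp add: cl)
    have "frakE p J (dom_plus p) (eta s) (qc s) t ?r
        = ?e * (y t * ?L)\<^sup>2 / (2 * (hc t)\<^sup>2) + (mut p)\<^sup>2 * y' t / hc t"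
      by (simp add: frakE_def C.dx_dt_q[OF t r] hgt_plus) (simp add: sel len_plus_def)
    moreover have "(Pint s t ?r - Pint s t (- ?r)) / ?e = - (alpha p * ?L * y' t)"
      using p by (simp add: sel alpha_def)
    moreover have "Pc s t ?r / ?e = c t"
      using p by (simp add: sel)
    ultimately show "(Pint s t ?r - Pint s t (- ?r)) / ?e =
       (eta s t ?r + Pc s t ?r / ?e + frakE p J (dom_plus p) (eta s) (qc s) t ?r)
       - (zm s t (- ?r) + Pm s t (- ?r) / ?e + frakE p J ?X (zm s) (qm s) t (- ?r))"
      by (simp add: sel(1,2,3,7) c_def)
  qed
  \<comment> \<open>Newton's law is the one equation not built into the construction; it is now
    equivalent to the assumed spring equation.\<close>
  have "newton_law p J s \<longleftrightarrow> spring_mass_trace_ode p J (zm s) (qm s) (zbar s)"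
    by (rule newton_law_iff[OF adm J _ _ _ _ _ _ _ _ C1_Pint C1_Pc mom_int mom_plus ii])
      (use C2 hc0 qr in \<open>auto simp: sel y_def\<close>)
  then have newton: "newton_law p J s"
    using ode by (simp add: sel)
  have "mass_eq J (dom_int p) (zi s) (qi s)" "mass_eq J (dom_plus p) (eta s) (qc s)"
    using closure_subset[of "dom_int p"] closure_subset[of "dom_plus p"]
    by (auto simp: mass_eq_def I.dt_z I.dx_q C.dt_z C.dx_q subset_iff)
  moreover have "positive_height p J (dom_int p) (zi s)" "positive_height p J (dom_plus p) (eta s)"
    using p hcp by (simp_all add: positive_height_def hgt_int hgt_plus)
  moreover have "regular_unknowns p J s"
    using reg C2 C1_Pm C1_Pint C1_Pc I.regular C.regular
    by (simp add: regular_unknowns_def sel(1,3,10))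
  ultimately have "fluid_column_system p J s"
    using pos mass far mom_m mom_int mom_plus newton
    by (simp add: fluid_column_system_def sel(1,3)) (simp add: sel)
  then show ?thesis
    using i ii that sel by blast
qed

theorem proposition5p5:
  fixes p :: params and J :: "real set"
  assumes "admissible p" and "time_interval J"
  shows "(\<forall>s. fluid_column_system p J s \<and> property_i p J s \<and> property_ii p J s \<longrightarrow>
            wave_spring_mass_system p J (zm s) (qm s) (zbar s) \<and>
            (\<forall>t\<in>J. (\<forall>x\<in>dom_int p. qi s t x = ddt J (zbar s) t * len_plus p) \<and>
                   (\<forall>x\<in>dom_plus p. eta s t x = eta_eq p + zbar s t \<and>
                                    qc s t x = ddt J (zbar s) t * (ell p - x)))) \<and>
         (\<forall>z q zb. wave_spring_mass_system p J z q zb \<longrightarrow>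
            (\<exists>s. fluid_column_system p J s \<and> property_i p J s \<and> property_ii p J s \<and>
                 zm s = z \<and> qm s = q \<and> zbar s = zb))"
proof (intro conjI allI impI)
  fix s assume s: "fluid_column_system p J s \<and> property_i p J s \<and> property_ii p J s"
  then show "wave_spring_mass_system p J (zm s) (qm s) (zbar s)"
    using fluid_column_imp_wave_spring_mass[OF assms] by blast
  show "\<forall>t\<in>J. (\<forall>x\<in>dom_int p. qi s t x = ddt J (zbar s) t * len_plus p) \<and>
      (\<forall>x\<in>dom_plus p. eta s t x = eta_eq p + zbar s t \<and> qc s t x = ddt J (zbar s) t * (ell p - x))"
    using s fluid_column_system_structure(2-4)[OF assms] closure_subset by blast
next
  fix z q zb assume "wave_spring_mass_system p J z q zb"
  then show "\<exists>s. fluid_column_system p J s \<and> property_i p J s \<and> property_ii p J s \<and>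
      zm s = z \<and> qm s = q \<and> zbar s = zb"
    using wave_spring_mass_imp_fluid_column[OF assms] by metis
qed

end
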